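(* Let $m=m(n)$ and $k=k(n)$ be positive integer sequences with $n\ll m\ll n^2/\log^2 n$ and $k\sim\alpha m/n$ for some fixed $\alpha>0$. For each $n$, let $\boldsymbol{\sigma}_{n,m}$ be a permutation chosen uniformly at random from the set of permutations of $[n]$ with exactly $m$ inversions. Then, for any sequence of positive integers $(j_n)$ with $j_n\leq n-k$, \[\lim_{n\to\infty}\mathbb{P}\big(\boldsymbol{\sigma}_{n,m}(j_n)>\boldsymbol{\sigma}_{n,m}(j_n+k)\big)=\frac{e^\alpha(\alpha-1)+1}{(e^\alpha-1)^2}<\frac12.\]
   Context: A permutation of length $n$ is a linear ordering $\sigma(1)\ldots\sigma(n)$ of $[n]$; an inversion is a pair $i<j$ with $\sigma(i)>\sigma(j)$. For sequences, $f\ll g$ means $f/g\to0$ and $f\sim g$ means $f/g\to1$ as $n\to\infty$. *)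

theory Defs
  imports
    "HOL-Probability.Probability"
    "HOL-Combinatorics.Permutations"
    "HOL-Library.Landau_Symbols"
begin

definition inversions :: "nat \<Rightarrow> (nat \<Rightarrow> nat) \<Rightarrow> (nat \<times> nat) set" where
  "inversions n \<sigma> = {(i, j). i \<in> {1..n} \<and> j \<in> {1..n} \<and> i < j \<and> \<sigma> i > \<sigma> j}"

definition perms_with_inversions :: "nat \<Rightarrow> nat \<Rightarrow> (nat \<Rightarrow> nat) set" where
  "perms_with_inversions n m = {\<sigma>. \<sigma> permutes {1..n} \<and> card (inversions n \<sigma>) = m}"

(* Only meaningful if perms_with_inversions n m is nonempty, i.e. if m <= n choose 2:
   pmf_of_set is unspecified on the empty set. *)
definition random_perm :: "nat \<Rightarrow> nat \<Rightarrow> (nat \<Rightarrow> nat) pmf" where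
  "random_perm n m = pmf_of_set (perms_with_inversions n m)"

end

theory Submission
  imports Defs "HOL-Real_Asymp.Real_Asymp"
begin

text \<open>
  List the positions of a permutation so that each new position lies to the left or to the right of
  all the previous ones: first those strictly between \<open>j\<close> and \<open>j + k\<close>, then \<open>j\<close>, then \<open>j + k\<close>, then
  the others. Counting, for the \<open>t\<close>-th listed position, the earlier ones that form an inversion with
  it gives a code \<open>e\<close> with \<open>e t < t\<close>. This is a bijection onto all such codes, the entries sum to
  the number of inversions, and \<open>\<sigma> j > \<sigma> (j + k)\<close> holds iff \<open>e k + e (k + 1) \<ge> k\<close>.

  Let \<open>a s\<close> be the number of codes of sum \<open>s\<close> without the entries \<open>k\<close> and \<open>k + 1\<close>. The sequence
  \<open>a\<close> is log-concave, so its ratios \<open>a (s - 1) / a s\<close> increase with \<open>s\<close>. Since the means of the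
  entries of a random code of sum \<open>s\<close> add up to \<open>s\<close>, comparing these means with those of geometric
  variables shows that the ratio is \<open>1 - (1 + o(1)) n / s\<close> for \<open>n \<lless> s \<lless> n\<^sup>2\<close>. Hence
  \<open>a (m - d)\<close> is close to \<open>q ^ d * a m\<close> with \<open>q = 1 - n / m\<close> for all \<open>d \<le> 2 k\<close>, and the
  probability is asymptotic to a quotient of two explicit geometric sums.
\<close>

section \<open>Counting codes\<close>

text \<open>Inversion tables with index set \<open>I\<close>. Index 0 admits no value at all, so
  \<open>codes I\<close> is empty once \<open>0 \<in> I\<close>; this explains the hypothesis
  \<open>0 \<notin> I\<close> in \<open>code_count_pos\<close>.\<close>

definition codes :: "nat set \<Rightarrow> (nat \<Rightarrow> nat) set" where
  "codes I = (\<Pi>\<^sub>E i\<in>I. {..<i})"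

text \<open>For finite \<open>I\<close>, the coefficient of x^s in the product of 1 + x + ... +
  x^(i-1) over \<open>i\<close> in \<open>I\<close>. The integer argument lets the shifts in the
  convolution identities run below 0, where the count vanishes.\<close>

definition code_count :: "nat set \<Rightarrow> int \<Rightarrow> real" where
  "code_count I s = (\<Sum>e\<in>codes I. of_bool (int (\<Sum>i\<in>I. e i) = s))"

lemma finite_codes: "finite I \<Longrightarrow> finite (codes I)"
  unfolding codes_def by (rule finite_PiE) auto

lemma card_codes: "card (codes {1..n}) = fact n"
  by (simp add: codes_def card_PiE fact_prod)

lemma sum_codes_insert:
  fixes F :: "(nat \<Rightarrow> nat) \<Rightarrow> real"
  assumes "finite I" "i \<notin> I"
  shows "(\<Sum>e\<in>codes (insert i I). F e) = (\<Sum>t<i. \<Sum>e\<in>codes I. F (e(i := t)))"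
proof -
  have inj: "inj_on (\<lambda>(t, e). e(i := t)) ({..<i} \<times> codes I)"
    using assms inj_combinator[of i I "\<lambda>i. {..<i}"] by (auto simp: codes_def)
  have "codes (insert i I) = (\<lambda>(t, e). e(i := t)) ` ({..<i} \<times> codes I)"
    by (simp add: codes_def PiE_insert_eq)
  then have "(\<Sum>e\<in>codes (insert i I). F e) = (\<Sum>(t, e)\<in>{..<i} \<times> codes I. F (e(i := t)))"
    using sum.reindex[OF inj, of F] by (simp add: case_prod_unfold)
  then show ?thesis
    by (simp add: sum.cartesian_product)
qed

lemma sum_upd_insert:
  fixes e :: "nat \<Rightarrow> nat"
  assumes "finite I" "i \<notin> I"
  shows "(\<Sum>l\<in>insert i I. (e(i := t)) l) = t + (\<Sum>l\<in>I. e l)"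
proof -
  have "(\<Sum>l\<in>I. (e(i := t)) l) = (\<Sum>l\<in>I. e l)"
    using assms by (intro sum.cong) auto
  then show ?thesis using assms by simp
qed

text \<open>Serves two purposes: weight 1 gives the convolution recurrence, and the identity weight
  gives the first moment of a single entry.\<close>

lemma weighted_code_count_insert:
  fixes h :: "nat \<Rightarrow> real"
  assumes "finite I" "i \<notin> I"
  shows "(\<Sum>e\<in>codes (insert i I). h (e i) * of_bool (int (\<Sum>l\<in>insert i I. e l) = s))
       = (\<Sum>t<i. h t * code_count I (s - int t))"
  unfolding sum_codes_insert[OF assms] sum_upd_insert[OF assms] code_count_def sum_distrib_left
  by (intro sum.cong refl) (auto simp: algebra_simps)

lemma code_count_insert:
  assumes "finite I" "i \<notin> I"
  shows "code_count (insert i I) s = (\<Sum>t<i. code_count I (s - int t))"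
  using weighted_code_count_insert[OF assms, of "\<lambda>_. 1" s] by (simp add: code_count_def)

lemma code_count_empty: "code_count {} s = of_bool (s = 0)"
  by (auto simp: code_count_def codes_def)

lemma code_count_nonneg: "code_count I s \<ge> 0"
  by (simp add: code_count_def sum_nonneg)

lemma code_count_remove:
  assumes "finite I" "i \<in> I"
  shows "code_count I s = (\<Sum>t<i. code_count (I - {i}) (s - int t))"
  using code_count_insert[of "I - {i}" i s] assms by (simp add: insert_absorb)

lemma code_count_pos:
  assumes "finite I" "0 \<notin> I" "0 \<le> s" "s \<le> int (\<Sum>i\<in>I. i - 1)"
  shows "code_count I s > 0"
  using assms
proof (induction I arbitrary: s rule: finite_induct)
  case empty
  then show ?case by (simp add: code_count_empty)
next
  case (insert i I)
  \<comment> \<open>Greedy choice: entry \<open>i\<close> absorbs as much of \<open>s\<close> as it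
    can, and the remainder is within reach of the other entries.\<close>
  define t where "t = min (nat s) (i - 1)"
  have t: "t < i" "0 \<le> s - int t" "s - int t \<le> int (\<Sum>i\<in>I. i - 1)"
    using insert.prems insert.hyps by (auto simp: t_def min_def sum_nonneg intro!: Nat.gr0I)
  then have "0 < code_count I (s - int t)"
    using insert.IH insert.prems by auto
  also have "\<dots> \<le> (\<Sum>t<i. code_count I (s - int t))"
    using t by (intro member_le_sum) (auto simp: code_count_nonneg)
  finally show ?case using insert.hyps by (simp add: code_count_insert)
qed

text \<open>Double counting of the sum of all entries over all codes of sum \<open>s\<close>. Where
  the count is positive, dividing by it shows that the means of the entries of a random code add up
  to \<open>s\<close>.\<close>

lemma code_count_moment:
  assumes "finite I"
  shows "of_int s * code_count I s
       = (\<Sum>i\<in>I. \<Sum>t<i. real t * code_count (I - {i}) (s - int t))"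
proof -
  have "of_int s * code_count I s
      = (\<Sum>e\<in>codes I. \<Sum>i\<in>I. real (e i) * of_bool (int (\<Sum>l\<in>I. e l) = s))"
    unfolding code_count_def sum_distrib_left
    by (intro sum.cong refl) (auto simp: sum_distrib_right[symmetric])
  also have "\<dots> = (\<Sum>i\<in>I. \<Sum>e\<in>codes I. real (e i) * of_bool (int (\<Sum>l\<in>I. e l) = s))"
    by (rule sum.swap)
  also have "\<dots> = (\<Sum>i\<in>I. \<Sum>t<i. real t * code_count (I - {i}) (s - int t))"
  proof (rule sum.cong[OF refl])
    fix i assume "i \<in> I"
    then show "(\<Sum>e\<in>codes I. real (e i) * of_bool (int (\<Sum>l\<in>I. e l) = s))
      = (\<Sum>t<i. real t * code_count (I - {i}) (s - int t))"
      using weighted_code_count_insert[of "I - {i}" i real s] assms by (simp add: insert_absorb)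
  qed
  finally show ?thesis .
qed

section \<open>Log-concave sequences and the monotonicity of their ratios\<close>

definition log_concave :: "(int \<Rightarrow> real) \<Rightarrow> bool" where
  "log_concave c \<longleftrightarrow> (\<forall>x. c x \<ge> 0) \<and> (\<forall>x y. x \<le> y \<longrightarrow> c (x - 1) * c (y + 1) \<le> c x * c y)"

lemma log_concave_nonneg: "log_concave c \<Longrightarrow> c x \<ge> 0"
  by (simp add: log_concave_def)

lemma log_concave_shift:
  assumes "log_concave c" "x \<le> y"
  shows "c (x - int d) * c (y + int d) \<le> c x * c y"
proof (induction d)
  case (Suc d)
  have "c ((x - int d) - 1) * c ((y + int d) + 1) \<le> c (x - int d) * c (y + int d)"
    using assms by (simp add: log_concave_def)
  also note Suc
  finally show ?case by (simp add: algebra_simps)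
qed simp

text \<open>Of two pairs with the same sum, the more spread one has the smaller product. The
  two-point form of \<open>log_concave\<close>, which excludes zeros between positive values, makes
  this hold without any positivity assumption.\<close>

lemma log_concave_inner:
  assumes "log_concave c" "w + z = x + y" "w \<le> x" "w \<le> y"
  shows "c w * c z \<le> c x * c y"
proof (cases "x \<le> y")
  case True
  have z: "z = y + (x - w)" using assms by simp
  show ?thesis unfolding z using log_concave_shift[OF assms(1) True, of "nat (x - w)"] assms
    by simp
next
  case False
  have z: "z = x + (y - w)" using assms by simp
  show ?thesis unfolding z using False log_concave_shift[OF assms(1), of y x "nat (y - w)"] assms
    by (simp add: mult.commute)
qed

text \<open>Moving the window by one step gains one term and loses one. After these changes are
  inserted, the required inequality splits into \<open>first\<close> for the gained terms and
  \<open>second\<close> for the lost terms, and each of them holds summand by summand.\<close>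

lemma log_concave_box:
  assumes "log_concave c"
  shows "log_concave (\<lambda>x. \<Sum>t<i. c (x - int t))"
proof -
  define a where "a = (\<lambda>x. \<Sum>t<i. c (x - int t))"
  have step: "a (u + 1) = a u + c (u + 1) - c (u + 1 - int i)" for u
  proof -
    have "a (u + 1) + c (u + 1 - int i) = (\<Sum>t<Suc i. c (u + 1 - int t))"
      by (simp add: a_def)
    also have "\<dots> = c (u + 1) + a u"
      by (subst sum.lessThan_Suc_shift) (simp add: a_def algebra_simps)
    finally show ?thesis by simp
  qed
  have "a (u - 1) * a (v + 1) \<le> a u * a v" if "u \<le> v" for u v
  proof -
    have first: "c (v + 1) * a (u - 1) \<le> c u * a v"
      unfolding a_def sum_distrib_left
    proof (rule sum_mono)
      fix t
      show "c (v + 1) * c (u - 1 - int t) \<le> c u * c (v - int t)"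
        using log_concave_inner[OF assms, of "u - 1 - int t" "v + 1" u "v - int t"] that
        by (simp add: mult.commute)
    qed
    have second: "c (u - int i) * a v \<le> c (v + 1 - int i) * a (u - 1)"
      unfolding a_def sum_distrib_left
    proof (rule sum_mono)
      fix t assume "t \<in> {..<i}"
      then show "c (u - int i) * c (v - int t) \<le> c (v + 1 - int i) * c (u - 1 - int t)"
        using log_concave_inner[OF assms, of "u - int i" "v - int t" "v + 1 - int i" "u - 1 - int t"] that
        by simp
    qed
    moreover have "a u - a (u - 1) = c u - c (u - int i)" using step[of "u - 1"] by simp
    moreover have "a (v + 1) - a v = c (v + 1) - c (v + 1 - int i)" using step[of v] by simp
    moreover have "a u * a v - a (u - 1) * a (v + 1)
      = (a u - a (u - 1)) * a v - (a (v + 1) - a v) * a (u - 1)"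
      by (simp add: algebra_simps)
    ultimately have "a u * a v - a (u - 1) * a (v + 1)
      = (c u - c (u - int i)) * a v - (c (v + 1) - c (v + 1 - int i)) * a (u - 1)"
      by simp
    then show ?thesis using first second by (simp add: left_diff_distrib)
  qed
  moreover have "a x \<ge> 0" for x
    using assms by (simp add: a_def log_concave_def sum_nonneg)
  ultimately show ?thesis by (simp add: log_concave_def a_def)
qed

lemma log_concave_code_count:
  assumes "finite I"
  shows "log_concave (code_count I)"
  using assms
proof (induction I rule: finite_induct)
  case empty
  then show ?case by (auto simp: log_concave_def code_count_empty)
next
  case (insert i I)
  have "code_count (insert i I) = (\<lambda>s. \<Sum>t<i. code_count I (s - int t))"
    using insert.hyps by (simp add: fun_eq_iff code_count_insert)
  then show ?case using log_concave_box[OF insert.IH] by simp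
qed

text \<open>The ratio \<open>c (y - 1) / c y\<close> increases with \<open>y\<close>, so a lower
  bound at \<open>u\<close> persists above \<open>u\<close> and can be iterated \<open>d\<close>
  times. Working with products avoids dividing by values that may be zero.\<close>

lemma log_concave_ratio_lower:
  assumes "log_concave c" "c u > 0" "r \<ge> 0" "r * c u \<le> c (u - 1)" "u \<le> x"
  shows "r ^ d * c (x + int d) \<le> c x"
proof (induction d)
  case (Suc d)
  have "r * c u * c (x + int d + 1) \<le> c (u - 1) * c (x + int d + 1)"
    using assms by (intro mult_right_mono) (auto simp: log_concave_nonneg)
  also have "\<dots> \<le> c u * c (x + int d)"
    using assms by (intro log_concave_inner) auto
  finally have "r * c (x + int d + 1) \<le> c (x + int d)"
    using assms(2) by (simp add: mult.assoc mult.left_commute)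
  then have "r ^ d * (r * c (x + int d + 1)) \<le> r ^ d * c (x + int d)"
    using assms by (intro mult_left_mono) auto
  then show ?case using Suc by (simp add: algebra_simps)
qed simp

text \<open>The same monotonicity read downwards: an upper bound for the ratio at \<open>u\<close>
  persists below \<open>u\<close>.\<close>

lemma log_concave_ratio_upper:
  assumes "log_concave c" "c u > 0" "r \<ge> 0" "c (u - 1) \<le> r * c u"
  shows "c (u - int d) \<le> r ^ d * c u"
proof (induction d)
  case (Suc d)
  have "c (u - int d - 1) * c u \<le> c (u - int d) * c (u - 1)"
    using assms by (intro log_concave_inner) auto
  also have "\<dots> \<le> c (u - int d) * (r * c u)"
    using assms by (intro mult_left_mono) (auto simp: log_concave_nonneg)
  finally have "c (u - int d - 1) \<le> r * c (u - int d)"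
    using assms(2) by (simp add: mult.assoc[symmetric] mult.commute)
  also have "\<dots> \<le> r * (r ^ d * c u)"
    using Suc assms by (intro mult_left_mono) auto
  finally show ?case by (simp add: algebra_simps)
qed simp

section \<open>Bounds on the ratio of consecutive counts\<close>

text \<open>Let \<open>r\<close> be the ratio. If \<open>r < 1\<close>, each entry of a random code
  of sum \<open>s\<close> exceeds \<open>u\<close> with probability at most
  \<open>r ^ Suc u\<close>, so its mean is at most \<open>r / (1 - r)\<close>. The means add up to
  \<open>s\<close>, so \<open>s\<close> is at most \<open>card I\<close> times this bound; solving
  for \<open>r\<close> gives the claim.\<close>

lemma code_count_ratio_lower:
  assumes "finite I" "code_count I s > 0" "s \<ge> 0"
  shows "of_int s / (of_int s + real (card I)) \<le> code_count I (s - 1) / code_count I s"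
proof -
  define a where "a = code_count I"
  define r where "r = a (s - 1) / a s"
  have a0: "a x \<ge> 0" for x by (simp add: a_def code_count_nonneg)
  have as: "a s > 0" using assms by (simp add: a_def)
  have r0: "r \<ge> 0" using a0 by (simp add: r_def)
  have lc: "log_concave a" using assms(1) by (simp add: a_def log_concave_code_count)
  have r: "a (s - 1) \<le> r * a s" using as by (simp add: r_def)
  show ?thesis
  proof (cases "r < 1")
    case False
    have "of_int s / (of_int s + real (card I)) \<le> 1"
      using assms(3) by (auto simp: divide_le_eq_1 not_less order_le_less)
    then show ?thesis using False by (simp add: r_def a_def)
  next
    case True
    have one: "(\<Sum>t<i. real t * code_count (I - {i}) (s - int t)) \<le> a s * (r / (1 - r))"
      if i: "i \<in> I" for i
    proof -
      define c where "c = code_count (I - {i})"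
      have ac: "a x = (\<Sum>t<i. c (x - int t))" for x
        using code_count_remove[OF assms(1) i] by (simp add: a_def c_def)
      have c0: "c x \<ge> 0" for x by (simp add: c_def code_count_nonneg)
      \<comment> \<open>The mean is rewritten as a sum of tails.\<close>
      have "(\<Sum>t<i. real t * c (s - int t)) = (\<Sum>t<i. \<Sum>u<t. c (s - int t))"
        by simp
      also have "\<dots> = (\<Sum>u<i. \<Sum>t\<in>{Suc u..<i}. c (s - int t))"
      proof -
        have "(\<Sum>t<i. \<Sum>u<t. c (s - int t)) = (\<Sum>t<i. \<Sum>u | u \<in> {..<i} \<and> u < t. c (s - int t))"
          by (intro sum.cong arg_cong2[where f = sum] refl) auto
        also have "\<dots> = (\<Sum>u<i. \<Sum>t | t \<in> {..<i} \<and> u < t. c (s - int t))"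
          by (rule sum.swap_restrict) auto
        also have "\<dots> = (\<Sum>u<i. \<Sum>t\<in>{Suc u..<i}. c (s - int t))"
          by (intro sum.cong arg_cong2[where f = sum] refl) auto
        finally show ?thesis .
      qed
      also have "\<dots> \<le> (\<Sum>u<i. a (s - int (Suc u)))"
      proof (rule sum_mono)
        fix u assume "u \<in> {..<i}"
        have "(\<Sum>t\<in>{Suc u..<i}. c (s - int t)) = (\<Sum>v\<in>{0..<i - Suc u}. c (s - int (v + Suc u)))"
          using \<open>u \<in> {..<i}\<close> sum.shift_bounds_nat_ivl[of "\<lambda>t. c (s - int t)" 0 "Suc u" "i - Suc u"]
          by simp
        \<comment> \<open>Subtracting \<open>Suc u\<close> from entry \<open>i\<close> embeds the
          tail into the codes of sum \<open>s - Suc u\<close>; the added terms complete that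
          count.\<close>
        also have "\<dots> \<le> (\<Sum>v<i. c (s - int (v + Suc u)))"
          by (rule sum_mono2) (auto simp: c0)
        also have "\<dots> = a (s - int (Suc u))"
          by (simp add: ac algebra_simps)
        finally show "(\<Sum>t\<in>{Suc u..<i}. c (s - int t)) \<le> a (s - int (Suc u))" .
      qed
      also have "\<dots> \<le> (\<Sum>u<i. r ^ Suc u * a s)"
        by (intro sum_mono log_concave_ratio_upper lc as r0 r)
      also have "\<dots> = a s * (r * (\<Sum>u<i. r ^ u))"
        by (simp add: sum_distrib_left sum_distrib_right mult_ac)
      also have "\<dots> = a s * (r * ((1 - r ^ i) / (1 - r)))"
        using True by (simp add: sum_gp_strict)
      also have "\<dots> \<le> a s * (r * (1 / (1 - r)))"
        using True r0 as by (intro mult_left_mono divide_right_mono) auto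
      finally show ?thesis by (simp add: c_def)
    qed
    have "of_int s * a s \<le> (\<Sum>i\<in>I. a s * (r / (1 - r)))"
      unfolding a_def code_count_moment[OF assms(1)]
      by (intro sum_mono) (use one in \<open>simp add: a_def\<close>)
    then have "a s * of_int s \<le> a s * (real (card I) * (r / (1 - r)))"
      by (simp add: mult_ac)
    then have "of_int s \<le> real (card I) * (r / (1 - r))"
      using as by (subst (asm) mult_le_cancel_left_pos)
    then have "of_int s * (1 - r) \<le> real (card I) * r"
      using True by (simp add: field_simps)
    then have "of_int s \<le> r * (of_int s + real (card I))"
      by (simp add: algebra_simps)
    moreover have "of_int s + real (card I) > 0 \<or> of_int s + real (card I) = 0" using assms(3)
      by (metis add_nonneg_nonneg antisym_conv1 of_int_0_le_iff of_nat_0_le_iff order_le_less)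
    ultimately have "of_int s / (of_int s + real (card I)) \<le> r"
      using r0 by (auto simp: pos_divide_le_eq)
    then show ?thesis by (simp add: r_def a_def)
  qed
qed

text \<open>The truncated geometric weights \<open>r ^ t\<close> have a smaller mean than the weights \<open>w t\<close>, because
  the likelihood ratio \<open>w t / r ^ t\<close> increases.\<close>

lemma truncated_geometric_mean_le:
  fixes w :: "nat \<Rightarrow> real"
  assumes "0 < r" and M: "0 < M" "M \<le> i" and w0: "\<And>t. w t \<ge> 0"
    and w: "\<And>t u. t \<le> u \<Longrightarrow> u < M \<Longrightarrow> w t * r ^ (u - t) \<le> w u"
  shows "(\<Sum>t<M. real t * r ^ t) / (\<Sum>t<M. r ^ t) * (\<Sum>t<i. w t) \<le> (\<Sum>t<i. real t * w t)"
proof -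
  define S where "S = (\<Sum>t<M. r ^ t)"
  define g where "g = (\<Sum>t<M. real t * r ^ t) / S"
  have S: "S > 0" unfolding S_def using assms by (intro sum_pos) auto
  have "(\<Sum>t<M. real t * r ^ t) \<le> (\<Sum>t<M. real (M - 1) * r ^ t)"
    using assms by (intro sum_mono mult_right_mono) auto
  then have "(\<Sum>t<M. real t * r ^ t) \<le> real (M - 1) * S"
    by (simp add: S_def sum_distrib_left)
  then have gM: "g \<le> real (M - 1)" using S by (simp add: g_def pos_divide_le_eq)
  have g0: "g \<ge> 0" unfolding g_def using S assms by (intro divide_nonneg_pos sum_nonneg) auto
  \<comment> \<open>\<open>t0\<close> is the last index at which \<open>real t - g\<close> is not
    positive. With \<open>C\<close> chosen so that \<open>C * r ^ t\<close> and \<open>w t\<close>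
    agree at \<open>t0\<close>, both \<open>real t - g\<close> and \<open>w t - C * r ^ t\<close>
    change sign there, so their product is nonnegative for all \<open>t < M\<close>.\<close>
  define t0 where "t0 = nat \<lfloor>g\<rfloor>"
  have t0: "t0 < M" using gM g0 M unfolding t0_def by linarith
  have t0g: "real t \<le> g \<longleftrightarrow> t \<le> t0" for t
    unfolding t0_def using g0 by (simp add: le_nat_floor le_nat_iff le_floor_iff)
  define C where "C = w t0 / r ^ t0"
  have C: "C * ((real t - g) * r ^ t) \<le> (real t - g) * w t" if "t < M" for t
  proof (cases "t \<le> t0")
    case True
    have "w t * r ^ (t0 - t) \<le> w t0" using w[OF True t0] .
    moreover have "r ^ t0 = r ^ (t0 - t) * r ^ t" using True by (simp flip: power_add)
    ultimately have "w t \<le> C * r ^ t"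
      using assms by (simp add: C_def field_simps)
    then have "(real t - g) * (C * r ^ t) \<le> (real t - g) * w t"
      using t0g[of t] True by (intro mult_left_mono_neg) auto
    then show ?thesis by (simp add: mult_ac)
  next
    case False
    then have "w t0 * r ^ (t - t0) \<le> w t" using w[of t0 t] that by simp
    moreover have "r ^ t = r ^ (t - t0) * r ^ t0" using False by (simp flip: power_add)
    ultimately have "C * r ^ t \<le> w t"
      using assms by (simp add: C_def field_simps)
    then have "(real t - g) * (C * r ^ t) \<le> (real t - g) * w t"
      using t0g[of t] False by (intro mult_left_mono) auto
    then show ?thesis by (simp add: mult_ac)
  qed
  have "0 = C * (\<Sum>t<M. (real t - g) * r ^ t)"
  proof -
    have "(\<Sum>t<M. (real t - g) * r ^ t) = (\<Sum>t<M. real t * r ^ t) - g * S"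
      by (simp add: left_diff_distrib sum_subtractf S_def sum_distrib_left)
    also have "\<dots> = 0" using S by (simp add: g_def)
    finally show ?thesis by simp
  qed
  also have "\<dots> \<le> (\<Sum>t<M. (real t - g) * w t)"
    unfolding sum_distrib_left by (intro sum_mono C) auto
  \<comment> \<open>The added terms have \<open>t \<ge> M\<close>, beyond the mean
    \<open>g \<le> M - 1\<close>.\<close>
  also have "\<dots> \<le> (\<Sum>t<i. (real t - g) * w t)"
    using M gM w0 by (intro sum_mono2 mult_nonneg_nonneg) (auto intro: order_trans)
  also have "\<dots> = (\<Sum>t<i. real t * w t) - g * (\<Sum>t<i. w t)"
    by (simp add: left_diff_distrib sum_subtractf sum_distrib_left)
  finally show ?thesis by (simp add: g_def S_def)
qed

text \<open>A ratio of at least \<open>r\<close> at \<open>s\<close> forces large entries. In a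
  random code of sum \<open>s + M\<close>, the weights of an entry \<open>i \<ge> M\<close> dominate
  a truncated geometric law in likelihood ratio, so its mean is at least the truncated geometric
  mean. All means together give \<open>s + M\<close>. The shift by \<open>M\<close> keeps the
  arguments \<open>s + M - t\<close> with \<open>t < M\<close> above \<open>s\<close>.\<close>

lemma code_count_ratio_upper:
  assumes "finite I" "code_count I s > 0" "code_count I (s + int M) > 0" "0 < r" "0 < M"
    and "r * code_count I s \<le> code_count I (s - 1)"
  shows "real (card {i\<in>I. M \<le> i}) * ((\<Sum>t<M. real t * r ^ t) / (\<Sum>t<M. r ^ t))
       \<le> of_int (s + int M)"
proof -
  define a where "a = code_count I"
  define g where "g = (\<Sum>t<M. real t * r ^ t) / (\<Sum>t<M. r ^ t)"
  have one: "g * a (s + int M) \<le> (\<Sum>t<i. real t * code_count (I - {i}) (s + int M - int t))"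
    if i: "i \<in> I" "M \<le> i" for i
  proof -
    define c where "c = code_count (I - {i})"
    have ac: "a x = (\<Sum>t<i. c (x - int t))" for x
      using code_count_remove[OF assms(1) i(1)] by (simp add: a_def c_def)
    have lc: "log_concave c" using assms(1) by (simp add: c_def log_concave_code_count)
    have c0: "c x \<ge> 0" for x by (simp add: c_def code_count_nonneg)
    \<comment> \<open>The count \<open>a\<close> is a window sum of \<open>c\<close>, so its ratio
      at \<open>s\<close> is bounded by the ratios of \<open>c\<close> at points up to
      \<open>s\<close>, and hence by the ratio of \<open>c\<close> at any
      \<open>x \<ge> s\<close>.\<close>
    have step: "r * c x \<le> c (x - 1)" if "s \<le> x" for x
    proof -
      have "a (s - 1) * c x \<le> a s * c (x - 1)"
        unfolding ac sum_distrib_right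
      proof (rule sum_mono)
        fix t
        show "c (s - 1 - int t) * c x \<le> c (s - int t) * c (x - 1)"
          using that by (intro log_concave_inner lc) auto
      qed
      moreover have "r * a s * c x \<le> a (s - 1) * c x"
        using assms by (intro mult_right_mono c0) (auto simp: a_def)
      ultimately have "a s * (r * c x) \<le> a s * c (x - 1)" by (simp add: mult_ac)
      then show ?thesis using assms by (simp add: a_def)
    qed
    have "g * (\<Sum>t<i. c (s + int M - int t)) \<le> (\<Sum>t<i. real t * c (s + int M - int t))"
      unfolding g_def
    proof (rule truncated_geometric_mean_le[OF assms(4,5) i(2)])
      fix t u :: nat assume tu: "t \<le> u" "u < M"
      have "r ^ d * c (x + int d) \<le> c x" if "s \<le> x" for d x
      proof (induction d)
        case (Suc d)
        have "r ^ d * (r * c (x + int d + 1)) \<le> r ^ d * c (x + int d)"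
          using step[of "x + int d + 1"] assms that by (intro mult_left_mono) auto
        then show ?case using Suc by (simp add: algebra_simps)
      qed simp
      from this[of "s + int M - int u" "u - t"]
      show "c (s + int M - int t) * r ^ (u - t) \<le> c (s + int M - int u)"
        using tu by (simp add: of_nat_diff mult.commute add_diff_eq)
    qed (rule c0)
    then show ?thesis by (simp add: ac c_def)
  qed
  have "real (card {i\<in>I. M \<le> i}) * g * a (s + int M)
      = (\<Sum>i\<in>{i\<in>I. M \<le> i}. g * a (s + int M))" by simp
  also have "\<dots> \<le> (\<Sum>i\<in>{i\<in>I. M \<le> i}. \<Sum>t<i. real t * code_count (I - {i}) (s + int M - int t))"
    by (intro sum_mono one) auto
  also have "\<dots> \<le> (\<Sum>i\<in>I. \<Sum>t<i. real t * code_count (I - {i}) (s + int M - int t))"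
    using assms(1) by (intro sum_mono2) (auto intro!: sum_nonneg simp: code_count_nonneg)
  also have "\<dots> = of_int (s + int M) * a (s + int M)"
    unfolding a_def code_count_moment[OF assms(1)] ..
  finally have "real (card {i\<in>I. M \<le> i}) * g \<le> of_int (s + int M)"
    using assms(3) by (subst (asm) mult_le_cancel_right_pos) (auto simp: a_def)
  then show ?thesis by (simp add: g_def)
qed

section \<open>Codes of permutations\<close>

definition inverted :: "(nat \<Rightarrow> nat) \<Rightarrow> nat \<Rightarrow> nat \<Rightarrow> bool" where
  "inverted \<sigma> x y \<longleftrightarrow> x < y \<and> \<sigma> y < \<sigma> x \<or> y < x \<and> \<sigma> x < \<sigma> y"

text \<open>For \<open>p\<close> the identity on \<open>{1..n}\<close> this is the usual inversion
  table. The restricted lambda makes the code extensional, as membership in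
  \<open>codes {1..n}\<close> requires.\<close>

definition order_code :: "nat \<Rightarrow> (nat \<Rightarrow> nat) \<Rightarrow> (nat \<Rightarrow> nat) \<Rightarrow> nat \<Rightarrow> nat" where
  "order_code n p \<sigma> = (\<lambda>t\<in>{1..n}. card {s\<in>{1..<t}. inverted \<sigma> (p s) (p t)})"

lemma order_code_in_codes: "order_code n p \<sigma> \<in> codes {1..n}"
proof -
  have "card {s\<in>{1..<t}. inverted \<sigma> (p s) (p t)} < t" if "t \<in> {1..n}" for t
  proof -
    have "card {s\<in>{1..<t}. inverted \<sigma> (p s) (p t)} \<le> card {1..<t}"
      by (intro card_mono) auto
    then show ?thesis using that by auto
  qed
  then show ?thesis by (auto simp: codes_def order_code_def)
qed

text \<open>Each inversion is counted exactly once, at whichever of its two positions is listed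
  later. The map \<open>h\<close> turns a pair of listing indices into the inversion, left position
  first.\<close>

lemma sum_order_code:
  assumes "bij_betw p {1..n} {1..n}"
  shows "(\<Sum>t\<in>{1..n}. order_code n p \<sigma> t) = card (inversions n \<sigma>)"
proof -
  define P where "P = (SIGMA t:{1..n}. {s\<in>{1..<t}. inverted \<sigma> (p s) (p t)})"
  define h where "h = (\<lambda>(t, s). (min (p s) (p t), max (p s) (p t)))"
  have inj: "inj_on p {1..n}" and img: "p ` {1..n} = {1..n}"
    using assms by (auto simp: bij_betw_def)
  have pin: "p t \<in> {1..n}" if "t \<in> {1..n}" for t using that img by blast
  have "inj_on h P"
  proof (rule inj_onI)
    fix x y assume xy: "x \<in> P" "y \<in> P" "h x = h y"
    obtain t s t' s' where eq: "x = (t, s)" "y = (t', s')" by fastforce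
    have "p s = p s' \<and> p t = p t' \<or> p s = p t' \<and> p t = p s'"
      using xy(3) by (auto simp: h_def eq min_def max_def split: if_splits)
    moreover have "s \<in> {1..n}" "t \<in> {1..n}" "s' \<in> {1..n}" "t' \<in> {1..n}" "s < t" "s' < t'"
      using xy by (auto simp: P_def eq)
    ultimately show "x = y" unfolding eq using inj_onD[OF inj, of s s'] inj_onD[OF inj, of t t']
      inj_onD[OF inj, of s t'] inj_onD[OF inj, of t s'] by auto
  qed
  moreover have "h ` P = inversions n \<sigma>"
  proof (intro equalityI subsetI)
    fix z assume "z \<in> h ` P"
    then obtain t s where ts: "t \<in> {1..n}" "s \<in> {1..<t}" "inverted \<sigma> (p s) (p t)" "z = h (t, s)"
      by (auto simp: P_def)
    moreover have "p t \<in> {1..n}" "p s \<in> {1..n}"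
      using pin[of t] pin[of s] ts by auto
    ultimately show "z \<in> inversions n \<sigma>"
      by (auto simp: inversions_def h_def inverted_def min_def max_def)
  next
    fix z assume "z \<in> inversions n \<sigma>"
    then obtain x y where z: "z = (x, y)" and xy: "x \<in> {1..n}" "y \<in> {1..n}" "x < y" "\<sigma> y < \<sigma> x"
      by (auto simp: inversions_def)
    from xy have "x \<in> p ` {1..n}" "y \<in> p ` {1..n}" unfolding img by auto
    then obtain s t where st: "s \<in> {1..n}" "t \<in> {1..n}" "x = p s" "y = p t" by blast
    then have "s \<noteq> t" using xy by auto
    then consider "s < t" | "t < s" by linarith
    then show "z \<in> h ` P"
    proof cases
      case 1
      then show ?thesis using xy st by (intro image_eqI[of _ _ "(t, s)"]) (auto simp: z h_def P_def inverted_def)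
    next
      case 2
      then show ?thesis using xy st by (intro image_eqI[of _ _ "(s, t)"]) (auto simp: z h_def P_def inverted_def)
    qed
  qed
  ultimately have "card (inversions n \<sigma>) = card P" using card_image by metis
  also have "\<dots> = (\<Sum>t\<in>{1..n}. order_code n p \<sigma> t)"
    by (simp add: P_def order_code_def)
  finally show ?thesis by simp
qed

text \<open>Two functions that order \<open>B\<close> alike have nested lower sets, and nested
  finite sets of equal size coincide.\<close>

lemma down_sets_equal:
  fixes \<sigma> \<tau> :: "'a \<Rightarrow> nat"
  assumes "finite B"
    and ord: "\<And>x y. x \<in> B \<Longrightarrow> y \<in> B \<Longrightarrow> \<sigma> x < \<sigma> y \<longleftrightarrow> \<tau> x < \<tau> y"
    and card: "card {x\<in>B. \<sigma> x < u} = card {x\<in>B. \<tau> x < v}"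
  shows "{x\<in>B. \<sigma> x < u} = {x\<in>B. \<tau> x < v}"
proof -
  have "{x\<in>B. \<sigma> x < u} \<subseteq> {x\<in>B. \<tau> x < v} \<or> {x\<in>B. \<tau> x < v} \<subseteq> {x\<in>B. \<sigma> x < u}"
  proof (rule ccontr)
    assume "\<not> ?thesis"
    then obtain x y where "x \<in> B" "y \<in> B" "\<sigma> x < u" "\<not> \<tau> x < v" "\<tau> y < v" "\<not> \<sigma> y < u"
      by blast
    then show False using ord[of x y] by linarith
  qed
  then show ?thesis using assms(1) card card_subset_eq[of "{x\<in>B. \<sigma> x < u}"]
      card_subset_eq[of "{x\<in>B. \<tau> x < v}"] by auto
qed

lemma permutes_eq_Suc_card_less:
  assumes "\<sigma> permutes {1..n::nat}" "x \<in> {1..n}"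
  shows "\<sigma> x = Suc (card {y\<in>{1..n}. \<sigma> y < \<sigma> x})"
proof -
  have sx: "\<sigma> x \<in> {1..n}" using assms permutes_in_image by metis
  have "\<sigma> ` {y\<in>{1..n}. \<sigma> y < \<sigma> x} = {z\<in>\<sigma> ` {1..n}. z < \<sigma> x}" by auto
  also have "\<dots> = {1..<\<sigma> x}"
    unfolding permutes_image[OF assms(1)] using sx by auto
  finally have "card {y\<in>{1..n}. \<sigma> y < \<sigma> x} = card {1..<\<sigma> x}"
    using card_image[OF inj_on_subset[OF permutes_inj[OF assms(1)] subset_UNIV]] by metis
  then show ?thesis using sx by simp
qed

text \<open>By induction on \<open>t\<close>, the code fixes the relative order of the values at the
  first \<open>t\<close> listed positions: since the new position is extremal, its entry tells how
  many earlier values lie below the new one. The full relative order then determines the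
  permutation, because each value is one more than the number of smaller values.\<close>

lemma order_code_inj:
  assumes p: "bij_betw p {1..n} {1..n}"
    and ext: "\<And>t. t \<in> {1..n} \<Longrightarrow> (\<forall>s\<in>{1..<t}. p s < p t) \<or> (\<forall>s\<in>{1..<t}. p t < p s)"
  shows "inj_on (order_code n p) {\<sigma>. \<sigma> permutes {1..n}}"
proof (rule inj_onI, clarify)
  fix \<sigma> \<tau> assume perm: "\<sigma> permutes {1..n}" "\<tau> permutes {1..n}"
    and eq: "order_code n p \<sigma> = order_code n p \<tau>"
  have inj: "inj_on p {1..n}" and img: "p ` {1..n} = {1..n}"
    using p by (auto simp: bij_betw_def)
  have neq: "\<rho> (p s) \<noteq> \<rho> (p t)" if "\<rho> permutes {1..n}" "s \<in> {1..n}" "t \<in> {1..n}" "s \<noteq> t" for \<rho> s t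
    using that inj_onD[OF inj] permutes_inj[OF that(1)] by (metis injD)
  have agree: "t \<le> n \<Longrightarrow> \<forall>x\<in>{1..t}. \<forall>y\<in>{1..t}. \<sigma> (p x) < \<sigma> (p y) \<longleftrightarrow> \<tau> (p x) < \<tau> (p y)" for t
  proof (induction t)
    case (Suc t)
    let ?T = "Suc t"
    have T: "?T \<in> {1..n}" using Suc.prems by simp
    \<comment> \<open>For a position to the right of all earlier ones, the inverted ones are those
      with larger values, hence the complement; to the left, they are those with smaller
      values.\<close>
    have below: "card {s\<in>{1..t}. \<rho> (p s) < \<rho> (p ?T)}
        = (if \<forall>s\<in>{1..<?T}. p s < p ?T then t - order_code n p \<rho> ?T else order_code n p \<rho> ?T)"
      if \<rho>: "\<rho> permutes {1..n}" for \<rho>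
    proof (cases "\<forall>s\<in>{1..<?T}. p s < p ?T")
      case True
      have "{s\<in>{1..t}. \<rho> (p s) < \<rho> (p ?T)} = {1..t} - {s\<in>{1..<?T}. inverted \<rho> (p s) (p ?T)}"
      proof (intro set_eqI)
        fix s
        show "s \<in> {s\<in>{1..t}. \<rho> (p s) < \<rho> (p ?T)}
            \<longleftrightarrow> s \<in> {1..t} - {s\<in>{1..<?T}. inverted \<rho> (p s) (p ?T)}"
        proof (cases "s \<in> {1..t}")
          case s: True
          then have "p s < p ?T" "\<rho> (p s) \<noteq> \<rho> (p ?T)"
            using True neq[OF \<rho> _ T, of s] Suc.prems by auto
          then show ?thesis using s by (auto simp: inverted_def)
        qed auto
      qed
      then have "card {s\<in>{1..t}. \<rho> (p s) < \<rho> (p ?T)} = t - order_code n p \<rho> ?T"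
        using T by (simp add: card_Diff_subset order_code_def subset_eq)
      then show ?thesis using True by simp
    next
      case False
      then have F: "\<forall>s\<in>{1..<?T}. p ?T < p s" using ext[OF T] by blast
      have "{s\<in>{1..t}. \<rho> (p s) < \<rho> (p ?T)} = {s\<in>{1..<?T}. inverted \<rho> (p s) (p ?T)}"
      proof (intro set_eqI)
        fix s
        show "s \<in> {s\<in>{1..t}. \<rho> (p s) < \<rho> (p ?T)}
            \<longleftrightarrow> s \<in> {s\<in>{1..<?T}. inverted \<rho> (p s) (p ?T)}"
        proof (cases "s \<in> {1..<?T}")
          case True
          then have "p ?T < p s" using F by blast
          then show ?thesis using True by (auto simp: inverted_def)
        qed auto
      qed
      then show ?thesis unfolding if_not_P[OF False] using T by (simp add: order_code_def)
    qed
    have IH: "\<forall>x\<in>{1..t}. \<forall>y\<in>{1..t}. \<sigma> (p x) < \<sigma> (p y) \<longleftrightarrow> \<tau> (p x) < \<tau> (p y)"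
      using Suc.IH Suc.prems Suc_leD by blast
    have "{s\<in>{1..t}. \<sigma> (p s) < \<sigma> (p ?T)} = {s\<in>{1..t}. \<tau> (p s) < \<tau> (p ?T)}"
    proof (rule down_sets_equal)
      show "card {s\<in>{1..t}. \<sigma> (p s) < \<sigma> (p ?T)} = card {s\<in>{1..t}. \<tau> (p s) < \<tau> (p ?T)}"
        unfolding below[OF perm(1)] below[OF perm(2)] eq ..
    qed (use IH in blast)+
    then have new: "\<sigma> (p s) < \<sigma> (p ?T) \<longleftrightarrow> \<tau> (p s) < \<tau> (p ?T)" if "s \<in> {1..t}" for s
      using that by blast
    have new': "\<sigma> (p ?T) < \<sigma> (p s) \<longleftrightarrow> \<tau> (p ?T) < \<tau> (p s)" if "s \<in> {1..t}" for s
      using new[OF that] neq[OF perm(1), of s ?T] neq[OF perm(2), of s ?T] that T Suc.prems by auto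
    have "{1..?T} = insert ?T {1..t}" by auto
    then show ?case using IH new new' by (metis insert_iff less_irrefl)
  qed simp
  have agree': "\<sigma> x < \<sigma> y \<longleftrightarrow> \<tau> x < \<tau> y" if xy: "x \<in> {1..n}" "y \<in> {1..n}" for x y
  proof -
    from xy have "x \<in> p ` {1..n}" "y \<in> p ` {1..n}" unfolding img by auto
    then obtain s t where "s \<in> {1..n}" "t \<in> {1..n}" "x = p s" "y = p t" by blast
    then show ?thesis using agree[OF order_refl] by blast
  qed
  show "\<sigma> = \<tau>"
  proof
    fix x
    show "\<sigma> x = \<tau> x"
    proof (cases "x \<in> {1..n}")
      case True
      have "{y\<in>{1..n}. \<sigma> y < \<sigma> x} = {y\<in>{1..n}. \<tau> y < \<tau> x}"
        using agree' True by blast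
      then show ?thesis
        using permutes_eq_Suc_card_less[OF perm(1) True] permutes_eq_Suc_card_less[OF perm(2) True] by simp
    next
      case False
      then show ?thesis using perm by (metis permutes_not_in)
    qed
  qed
qed

text \<open>Both sets have n! elements, so injectivity suffices.\<close>

lemma order_code_bij:
  assumes p: "bij_betw p {1..n} {1..n}"
    and ext: "\<And>t. t \<in> {1..n} \<Longrightarrow> (\<forall>s\<in>{1..<t}. p s < p t) \<or> (\<forall>s\<in>{1..<t}. p t < p s)"
  shows "bij_betw (order_code n p) {\<sigma>. \<sigma> permutes {1..n}} (codes {1..n})"
proof -
  note inj = order_code_inj[OF assms]
  have "card (order_code n p ` {\<sigma>. \<sigma> permutes {1..n}}) = card (codes {1..n})"
    using card_image[OF inj] card_permutations[of "{1..n}" n] by (simp only: card_codes) simp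
  then have "order_code n p ` {\<sigma>. \<sigma> permutes {1..n}} = codes {1..n}"
    by (intro card_subset_eq) (auto simp: finite_codes intro: order_code_in_codes simp del: One_nat_def)
  then show ?thesis using inj by (simp add: bij_betw_def)
qed

text \<open>The remaining positions on the left are listed downwards from \<open>j - 1\<close> to 1
  and those on the right upwards from \<open>j + k + 1\<close>, which keeps every new position
  extremal. Positions \<open>j\<close> and \<open>j + k\<close> get the indices \<open>k\<close> and
  \<open>Suc k\<close>.\<close>

definition window_order :: "nat \<Rightarrow> nat \<Rightarrow> nat \<Rightarrow> nat" where
  "window_order j k t = (if t < k then j + t else if t = k then j else if t = Suc k then j + k
     else if t \<le> k + j then j + k + 1 - t else t)"

lemma window_order_bij:
  assumes "j > 0" "k > 0" "j + k \<le> n"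
  shows "bij_betw (window_order j k) {1..n} {1..n}"
proof -
  have "inj_on (window_order j k) {1..n}"
    by (rule inj_onI) (use assms in \<open>auto simp: window_order_def split: if_splits\<close>)
  moreover have "window_order j k ` {1..n} \<subseteq> {1..n}"
    using assms by (auto simp: window_order_def)
  ultimately show ?thesis
    by (simp add: bij_betw_def endo_inj_surj)
qed

lemma window_order_extremal:
  assumes "j > 0" "k > 0"
  shows "(\<forall>s\<in>{1..<t}. window_order j k s < window_order j k t)
       \<or> (\<forall>s\<in>{1..<t}. window_order j k t < window_order j k s)"
proof -
  consider "t < k" | "t = k" | "t = Suc k" | "Suc k < t" "t \<le> k + j" | "k + j < t" by linarith
  then show ?thesis
    by cases (use assms in \<open>auto simp: window_order_def\<close>)
qed

text \<open>\<open>A\<close> and \<open>B\<close> collect the interior positions with values below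
  \<sigma> j and above \<sigma> (j + k). If the pair is inverted, they cover all
  \<open>k - 1\<close> interior positions, and \<open>e (Suc k)\<close> also counts
  \<open>j\<close>, so the sum reaches \<open>k\<close>. Otherwise they are disjoint, and the sum is
  at most \<open>k - 1\<close>.\<close>

lemma window_inversion_iff:
  assumes \<sigma>: "\<sigma> permutes {1..n}" and "j > 0" "k > 0" "j + k \<le> n"
  defines "e \<equiv> order_code n (window_order j k) \<sigma>"
  shows "\<sigma> (j + k) < \<sigma> j \<longleftrightarrow> k \<le> e k + e (Suc k)"
proof -
  define A where "A = {s\<in>{1..<k}. \<sigma> (j + s) < \<sigma> j}"
  define B where "B = {s\<in>{1..<k}. \<sigma> (j + k) < \<sigma> (j + s)}"
  have fin: "finite A" "finite B" by (auto simp: A_def B_def)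
  have "{s\<in>{1..<k}. inverted \<sigma> (window_order j k s) (window_order j k k)} = A"
    by (auto simp: A_def inverted_def window_order_def)
  then have ek: "e k = card A" using assms by (simp add: e_def order_code_def)
  have "{s\<in>{1..<Suc k}. inverted \<sigma> (window_order j k s) (window_order j k (Suc k))}
      = (if \<sigma> (j + k) < \<sigma> j then insert k B else B)"
    using assms by (auto simp: B_def inverted_def window_order_def less_Suc_eq)
  moreover have "k \<notin> B" by (simp add: B_def)
  ultimately have eSk: "e (Suc k) = (if \<sigma> (j + k) < \<sigma> j then Suc (card B) else card B)"
    using assms fin by (simp add: e_def order_code_def)
  show ?thesis
  proof (cases "\<sigma> (j + k) < \<sigma> j")
    case True
    then have "A \<union> B = {1..<k}" by (auto simp: A_def B_def)
    then have "k - 1 \<le> card A + card B" using card_Un_le[of A B] by simp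
    then show ?thesis using True ek eSk by simp
  next
    case False
    then have "A \<inter> B = {}" by (auto simp: A_def B_def)
    then have "card A + card B = card (A \<union> B)" using fin by (simp add: card_Un_disjoint)
    also have "\<dots> \<le> card {1..<k}" by (intro card_mono) (auto simp: A_def B_def)
    finally show ?thesis using False ek eSk assms by simp
  qed
qed

text \<open>The predicate \<open>Q\<close> yields the total count when it is always true and the
  count of the event when it is \<open>k \<le> f + f'\<close>.\<close>

lemma card_perms_with_inversions:
  assumes "j > 0" "k > 0" "j + k \<le> n"
  shows "real (card {\<sigma> \<in> perms_with_inversions n m. Q (order_code n (window_order j k) \<sigma> k)
            (order_code n (window_order j k) \<sigma> (Suc k))})
       = (\<Sum>f<k. \<Sum>f'<Suc k. of_bool (Q f f')
            * code_count ({1..n} - {k, Suc k}) (int m - int f - int f'))"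
proof -
  let ?p = "window_order j k"
  let ?I = "{1..n} - {k, Suc k}"
  note bij = order_code_bij[OF window_order_bij[OF assms] window_order_extremal[OF assms(1,2)]]
  have I1: "finite ?I" "Suc k \<notin> ?I" and I2: "finite (insert (Suc k) ?I)" "k \<notin> insert (Suc k) ?I"
    by auto
  have I: "insert k (insert (Suc k) ?I) = {1..n}" using assms by auto
  let ?E = "{e\<in>codes {1..n}. (\<Sum>t\<in>{1..n}. e t) = m \<and> Q (e k) (e (Suc k))}"
  have "bij_betw (order_code n ?p) {\<sigma> \<in> {\<sigma>. \<sigma> permutes {1..n}}.
      (\<Sum>t\<in>{1..n}. order_code n ?p \<sigma> t) = m \<and> Q (order_code n ?p \<sigma> k) (order_code n ?p \<sigma> (Suc k))} ?E"
    using bij by (rule bij_betw_Collect) auto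
  moreover have "{\<sigma> \<in> {\<sigma>. \<sigma> permutes {1..n}}. (\<Sum>t\<in>{1..n}. order_code n ?p \<sigma> t) = m
        \<and> Q (order_code n ?p \<sigma> k) (order_code n ?p \<sigma> (Suc k))}
      = {\<sigma> \<in> perms_with_inversions n m. Q (order_code n ?p \<sigma> k) (order_code n ?p \<sigma> (Suc k))}"
    unfolding perms_with_inversions_def sum_order_code[OF window_order_bij[OF assms]] by auto
  ultimately have "card {\<sigma> \<in> perms_with_inversions n m. Q (order_code n ?p \<sigma> k) (order_code n ?p \<sigma> (Suc k))}
      = card ?E" by (metis (no_types, lifting) bij_betw_same_card)
  also have "real (card ?E) = (\<Sum>e\<in>codes {1..n}. of_bool ((\<Sum>t\<in>{1..n}. e t) = m \<and> Q (e k) (e (Suc k))))"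
    using finite_codes[of "{1..n}"] by (simp add: of_bool_def sum.If_cases Int_def)
  also have "\<dots> = (\<Sum>e\<in>codes (insert k (insert (Suc k) ?I)).
      of_bool ((\<Sum>t\<in>insert k (insert (Suc k) ?I). e t) = m \<and> Q (e k) (e (Suc k))))"
    unfolding I ..
  also have "\<dots> = (\<Sum>f<k. \<Sum>f'<Suc k. \<Sum>e\<in>codes ?I.
      of_bool (f + (f' + (\<Sum>t\<in>?I. e t)) = m \<and> Q f f'))"
    unfolding sum_codes_insert[OF I2] sum_codes_insert[OF I1] sum_upd_insert[OF I2] sum_upd_insert[OF I1]
    by simp
  also have "\<dots> = (\<Sum>f<k. \<Sum>f'<Suc k. of_bool (Q f f') * code_count ?I (int m - int f - int f'))"
    unfolding code_count_def sum_distrib_left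
    by (intro sum.cong refl) (auto simp flip: of_nat_sum of_nat_add simp: algebra_simps)
  finally show ?thesis .
qed

lemma prob_window_inversion:
  assumes "j > 0" "k > 0" "j + k \<le> n"
  defines "a \<equiv> code_count ({1..n} - {k, Suc k})"
  assumes "a (int m) > 0"
  shows "measure_pmf.prob (random_perm n m) {\<sigma>. \<sigma> j > \<sigma> (j + k)}
       = (\<Sum>f<k. \<Sum>f'<Suc k. of_bool (k \<le> f + f') * a (int m - int (f + f')))
         / (\<Sum>f<k. \<Sum>f'<Suc k. a (int m - int (f + f')))"
proof -
  let ?S = "perms_with_inversions n m"
  have a0: "a x \<ge> 0" for x by (simp add: a_def code_count_nonneg)
  have total: "real (card ?S) = (\<Sum>f<k. \<Sum>f'<Suc k. a (int m - int (f + f')))"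
    using card_perms_with_inversions[OF assms(1-3), of m "\<lambda>_ _. True"]
    by (simp add: a_def algebra_simps)
  \<comment> \<open>The term with \<open>f = f' = 0\<close> is positive, so the set of permutations
    is nonempty and \<open>pmf_of_set\<close> is the uniform distribution on it.\<close>
  have "0 < a (int m - int (0 + 0))" using assms by simp
  also have "\<dots> \<le> (\<Sum>f'<Suc k. a (int m - int (0 + f')))"
    by (rule member_le_sum[where f = "\<lambda>f'. a (int m - int (0 + f'))"]) (auto simp: a0)
  also have "\<dots> \<le> (\<Sum>f<k. \<Sum>f'<Suc k. a (int m - int (f + f')))"
    using assms(2) by (intro member_le_sum[where f = "\<lambda>f. \<Sum>f'<Suc k. a (int m - int (f + f'))"])
      (auto intro!: sum_nonneg simp: a0 simp del: sum.lessThan_Suc)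
  finally have "card ?S > 0" using total by simp
  then have S: "?S \<noteq> {}" "finite ?S" by (auto simp: card_gt_0_iff)
  have "?S \<inter> {\<sigma>. \<sigma> j > \<sigma> (j + k)} = {\<sigma> \<in> ?S. k \<le> order_code n (window_order j k) \<sigma> k
      + order_code n (window_order j k) \<sigma> (Suc k)}"
    using window_inversion_iff[OF _ assms(1-3)] by (auto simp: perms_with_inversions_def)
  then have "real (card (?S \<inter> {\<sigma>. \<sigma> j > \<sigma> (j + k)}))
      = (\<Sum>f<k. \<Sum>f'<Suc k. of_bool (k \<le> f + f') * a (int m - int (f + f')))"
    using card_perms_with_inversions[OF assms(1-3), of m "\<lambda>f f'. k \<le> f + f'"]
    by (simp add: a_def algebra_simps)
  then show ?thesis
    unfolding random_perm_def measure_pmf_of_set[OF S] total by simp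
qed

section \<open>Asymptotics of the ratio\<close>

lemma truncated_geometric_mean:
  fixes r :: real
  assumes "0 < r" "r < 1" "0 < M"
  shows "(\<Sum>t<M. real t * r ^ t) / (\<Sum>t<M. r ^ t) = r / (1 - r) - real M * r ^ M / (1 - r ^ M)"
proof -
  have *: "(1 - r)\<^sup>2 * (\<Sum>t<M. real t * r ^ t) = r * (1 - r ^ M) - real M * r ^ M * (1 - r)" for M
    by (induction M) (simp_all add: algebra_simps power2_eq_square)
  define q where "q = r ^ M"
  have q: "q < 1" using assms by (simp add: power_less_one_iff q_def)
  have "(\<Sum>t<M. r ^ t) = (1 - q) / (1 - r)"
    using assms by (simp add: sum_gp_strict q_def)
  moreover have "(\<Sum>t<M. real t * r ^ t) = (r * (1 - q) - real M * q * (1 - r)) / (1 - r)\<^sup>2"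
    using *[of M] assms by (simp add: eq_divide_eq mult.commute q_def)
  ultimately have "(\<Sum>t<M. real t * r ^ t) / (\<Sum>t<M. r ^ t)
      = (r * (1 - q) - real M * q * (1 - r)) / (1 - r)\<^sup>2 / ((1 - q) / (1 - r))"
    by simp
  also have "\<dots> = r / (1 - r) - real M * q / (1 - q)"
    using assms q by (simp add: divide_simps) (simp add: algebra_simps power2_eq_square)
  finally show ?thesis by (simp add: q_def)
qed

lemma code_count_pos_asymp:
  fixes x :: "nat \<Rightarrow> nat" and I :: "nat \<Rightarrow> nat set"
  assumes I: "\<And>n. I n \<subseteq> {1..n}" "\<And>n. card ({1..n} - I n) \<le> 2"
    and x: "(\<lambda>n. real (x n) / (real n)\<^sup>2) \<longlonglongrightarrow> 0"
  shows "eventually (\<lambda>n. code_count (I n) (int (x n)) > 0) sequentially"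
proof -
  \<comment> \<open>The largest sum of a code over \<open>I n\<close> is at least n(n-1)/2 - 2n,
    which is at least n^2/4 once n \<ge> 10.\<close>
  have "eventually (\<lambda>n. real (x n) / (real n)\<^sup>2 < 1 / 4) sequentially"
    using x by (rule order_tendstoD) simp
  then show ?thesis
    using eventually_ge_at_top[of 10]
  proof eventually_elim
    case (elim n)
    have fin: "finite (I n)" using I(1) finite_subset by blast
    have "(\<Sum>i\<in>{1..n}. i - 1) = (\<Sum>i\<in>{1..n} - I n. i - 1) + (\<Sum>i\<in>I n. i - 1)"
      by (rule sum.subset_diff) (use I(1) in auto)
    moreover have "(\<Sum>i\<in>{1..n} - I n. i - 1) \<le> (\<Sum>i\<in>{1..n} - I n. n)"
      by (intro sum_mono) auto
    moreover have "(\<Sum>i\<in>{1..n} - I n. n) \<le> 2 * n" using I(2)[of n] by simp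
    ultimately have "(\<Sum>i\<in>{1..n}. i - 1) \<le> 2 * n + (\<Sum>i\<in>I n. i - 1)" by linarith
    then have "real (\<Sum>i\<in>{1..n}. i - 1) \<le> real (2 * n + (\<Sum>i\<in>I n. i - 1))"
      by (rule of_nat_mono)
    moreover have "real (\<Sum>i\<in>{1..n}. i - 1) = real n * (real n - 1) / 2" for n
      by (induction n) (auto simp: algebra_simps)
    ultimately have "real n * (real n - 1) / 2 \<le> 2 * real n + real (\<Sum>i\<in>I n. i - 1)"
      by (metis of_nat_add of_nat_mult of_nat_numeral)
    moreover have "10 * real n \<le> real n * real n" using elim by (intro mult_right_mono) auto
    moreover have "real (x n) < (real n)\<^sup>2 / 4" using elim by (simp add: divide_simps mult_ac)
    ultimately have "real (x n) \<le> real (\<Sum>i\<in>I n. i - 1)"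
      by (simp add: power2_eq_square algebra_simps del: of_nat_sum)
    then have "int (x n) \<le> int (\<Sum>i\<in>I n. i - 1)"
      by (simp del: of_nat_sum)
    moreover have "0 \<notin> I n" using I(1)[of n] by auto
    ultimately show ?case using fin by (intro code_count_pos) auto
  qed
qed

text \<open>Forces the ratio of consecutive counts to be at most \<open>1 - \<theta> n / s\<close>: otherwise
  all entries beyond \<open>M \<approx> \<surd>s\<close> have mean larger than \<open>s / n\<close>.
  The choice of \<open>M\<close> ensures \<open>s / n \<lless> M \<lless> n\<close>.\<close>

lemma truncated_means_exceed:
  fixes s :: "nat \<Rightarrow> nat" and \<theta> :: real
  assumes s1: "filterlim (\<lambda>n. real (s n) / real n) at_top sequentially"
    and s2: "(\<lambda>n. real (s n) / (real n)\<^sup>2) \<longlonglongrightarrow> 0"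
    and \<theta>: "0 < \<theta>" "\<theta> < 1"
  defines "M \<equiv> \<lambda>n. nat \<lceil>sqrt (real (s n))\<rceil>"
    and "r \<equiv> \<lambda>n. 1 - \<theta> * real n / real (s n)"
  shows "(\<lambda>n. real (M n) / real n) \<longlonglongrightarrow> 0"
    and "eventually (\<lambda>n. 0 < M n \<and> 0 < r n \<and> r n < 1 \<and> real (s n + M n) < (real n - 2 - real (M n))
           * ((\<Sum>t<M n. real t * r n ^ t) / (\<Sum>t<M n. r n ^ t))) sequentially"
proof -
  have inv: "(\<lambda>n. real n / real (s n)) \<longlonglongrightarrow> 0"
    using tendsto_inverse_0_at_top[OF s1] by (simp add: inverse_eq_divide)
  have n1: "(\<lambda>n. 1 / real n) \<longlonglongrightarrow> 0" by (rule lim_1_over_n)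
  have spos: "eventually (\<lambda>n. n > 0 \<and> s n > 0) sequentially"
    using filterlim_at_top_dense[THEN iffD1, OF s1, rule_format, of 0]
    by eventually_elim (auto intro!: Nat.gr0I)
  have sq: "(\<lambda>n. sqrt (real (s n)) / real n) \<longlonglongrightarrow> 0"
    using tendsto_real_sqrt[OF s2] by (simp add: real_sqrt_divide)
  have Mle: "real (M n) \<le> sqrt (real (s n)) + 1" and Mge: "sqrt (real (s n)) \<le> real (M n)" for n
    unfolding M_def by (simp_all add: real_nat_ceiling_ge)
  show Mn: "(\<lambda>n. real (M n) / real n) \<longlonglongrightarrow> 0"
  proof (rule tendsto_sandwich[of "\<lambda>_. 0"])
    show "(\<lambda>n. sqrt (real (s n)) / real n + 1 / real n) \<longlonglongrightarrow> 0"
      using tendsto_add[OF sq n1] by simp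
    show "eventually (\<lambda>n. real (M n) / real n \<le> sqrt (real (s n)) / real n + 1 / real n) sequentially"
      using Mle by (auto intro!: always_eventually divide_right_mono simp flip: add_divide_distrib)
  qed auto
  \<comment> \<open>\<open>y\<close> measures \<open>M\<close> on the scale \<open>s / n\<close> of
    the geometric mean. Since \<open>r ^ M \<le> z\<close> and \<open>y\<close> tends to infinity,
    cutting off at \<open>M\<close> costs only o(s/n).\<close>
  define y where "y = (\<lambda>n. real (M n) * real n / real (s n))"
  define z where "z = (\<lambda>n. exp (- \<theta> * y n))"
  have Ms: "(\<lambda>n. real (M n) / real (s n)) \<longlonglongrightarrow> 0"
  proof (rule Lim_transform_eventually)
    show "(\<lambda>n. (real (M n) / real n) * (real n / real (s n))) \<longlonglongrightarrow> 0"
      using tendsto_mult[OF Mn inv] by simp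
    show "eventually (\<lambda>n. (real (M n) / real n) * (real n / real (s n)) = real (M n) / real (s n)) sequentially"
      using spos by eventually_elim simp
  qed
  have y: "filterlim y at_top sequentially"
  proof (rule filterlim_at_top_mono)
    have "eventually (\<lambda>n. sqrt (real (s n)) / real n > 0) sequentially"
      using spos by eventually_elim simp
    with sq have "filterlim (\<lambda>n. sqrt (real (s n)) / real n) (at_right 0) sequentially"
      by (rule tendsto_imp_filterlim_at_right)
    then show "filterlim (\<lambda>n. inverse (sqrt (real (s n)) / real n)) at_top sequentially"
      by (rule filterlim_compose[OF filterlim_inverse_at_top_right])
    show "eventually (\<lambda>n. inverse (sqrt (real (s n)) / real n) \<le> y n) sequentially"
      using spos
    proof eventually_elim
      case (elim n)
      have "inverse (sqrt (real (s n)) / real n) = sqrt (real (s n)) * real n / real (s n)"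
        using elim by (simp add: field_simps)
      also have "\<dots> \<le> y n" unfolding y_def
        using Mge by (intro divide_right_mono mult_right_mono) auto
      finally show ?case .
    qed
  qed
  have yz: "(\<lambda>n. y n * z n / (1 - z n)) \<longlonglongrightarrow> 0"
  proof -
    have "((\<lambda>y. y * exp (- \<theta> * y) / (1 - exp (- \<theta> * y))) \<longlongrightarrow> 0) at_top"
      using \<theta> by real_asymp
    from filterlim_compose[OF this y] show ?thesis by (simp add: z_def)
  qed
  have r1: "r \<longlonglongrightarrow> 1"
    unfolding r_def using tendsto_diff[OF tendsto_const tendsto_mult[OF tendsto_const inv], of 1 \<theta>] by simp
  \<comment> \<open>A lower bound for the difference of the two sides of the desired inequality,
    divided by \<open>s\<close>, with \<open>z\<close> in place of \<open>r ^ M\<close>. Its limit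
    1/\<theta> - 1 is positive.\<close>
  define L where "L = (\<lambda>n. (1 - 2 * (1 / real n) - real (M n) / real n) * (r n / \<theta> - y n * z n / (1 - z n))
      - (1 + real (M n) / real (s n)))"
  have "L \<longlonglongrightarrow> (1 - 2 * 0 - 0) * (1 / \<theta> - 0) - (1 + 0)"
    unfolding L_def using \<theta> by (intro tendsto_intros n1 Mn r1 yz Ms) auto
  then have L: "eventually (\<lambda>n. L n > 0) sequentially"
    by (rule order_tendstoD) (use \<theta> in simp)
  have rpos: "eventually (\<lambda>n. r n > 0) sequentially"
    using r1 by (rule order_tendstoD) simp
  have Mn1: "eventually (\<lambda>n. 1 - 2 * (1 / real n) - real (M n) / real n > 0) sequentially"
  proof (rule order_tendstoD)
    show "(\<lambda>n. 1 - 2 * (1 / real n) - real (M n) / real n) \<longlonglongrightarrow> 1 - 2 * 0 - 0"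
      by (intro tendsto_intros n1 Mn)
  qed simp
  show "eventually (\<lambda>n. 0 < M n \<and> 0 < r n \<and> r n < 1 \<and> real (s n + M n) < (real n - 2 - real (M n))
           * ((\<Sum>t<M n. real t * r n ^ t) / (\<Sum>t<M n. r n ^ t))) sequentially"
    using L rpos Mn1 spos
  proof eventually_elim
    case (elim n)
    have n: "real n > 0" and sp: "real (s n) > 0" using elim by auto
    have "0 < sqrt (real (s n))" using sp by simp
    then have M0: "M n > 0" using Mge[of n] by (metis of_nat_0_less_iff less_le_trans)
    have lt1: "r n < 1" using \<theta> n sp by (simp add: r_def)
    have y0: "y n > 0" using M0 n sp by (simp add: y_def)
    have z1: "z n < 1" using y0 \<theta> by (simp add: z_def)
    have "r n ^ M n \<le> exp (- (\<theta> * real n / real (s n))) ^ M n"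
      using elim exp_ge_add_one_self[of "- (\<theta> * real n / real (s n))"]
      by (intro power_mono) (auto simp: r_def)
    also have "\<dots> = z n"
      by (simp add: z_def y_def flip: exp_of_nat_mult)
    finally have rz: "r n ^ M n \<le> z n" .
    have frac: "r n ^ M n / (1 - r n ^ M n) \<le> z n / (1 - z n)"
      using rz z1 elim by (intro frac_le) (auto simp: z_def)
    have "s n * (1 + real (M n) / real (s n))
        < s n * ((1 - 2 * (1 / real n) - real (M n) / real n) * (r n / \<theta> - y n * z n / (1 - z n)))"
      using elim sp by (intro mult_strict_left_mono) (auto simp: L_def)
    then have "real (s n + M n)
        < s n * ((1 - 2 * (1 / real n) - real (M n) / real n) * (r n / \<theta> - y n * z n / (1 - z n)))"
      using sp by (simp add: algebra_simps)
    also have "\<dots> = (real n - 2 - real (M n)) * (r n * real (s n) / (\<theta> * real n) - real (M n) * (z n / (1 - z n)))"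
      using n sp \<theta> z1 by (simp add: y_def divide_simps)
    also have "\<dots> \<le> (real n - 2 - real (M n)) * (r n * real (s n) / (\<theta> * real n) - real (M n) * (r n ^ M n / (1 - r n ^ M n)))"
    proof (intro mult_left_mono diff_left_mono frac)
      have "real n * (1 - 2 * (1 / real n) - real (M n) / real n) > 0"
        using n elim by (intro mult_pos_pos) auto
      then show "0 \<le> real n - 2 - real (M n)" using n by (simp add: algebra_simps)
    qed auto
    also have "r n * real (s n) / (\<theta> * real n) = r n / (1 - r n)"
      by (simp add: r_def)
    also have "r n / (1 - r n) - real (M n) * (r n ^ M n / (1 - r n ^ M n))
        = (\<Sum>t<M n. real t * r n ^ t) / (\<Sum>t<M n. r n ^ t)"
      using truncated_geometric_mean[of "r n" "M n"] elim lt1 M0 by simp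
    finally show ?case using M0 elim lt1 by simp
  qed
qed

text \<open>The upper bound is \<open>code_count_ratio_lower\<close> with at most \<open>n\<close>
  indices. For the lower bound, a ratio of at least 1 - \<theta> n/s with \<theta> < 1 would make
  the means in \<open>code_count_ratio_upper\<close> exceed their total, by
  \<open>truncated_means_exceed\<close>.\<close>

lemma code_count_ratio_asymp:
  fixes s :: "nat \<Rightarrow> nat" and I :: "nat \<Rightarrow> nat set"
  assumes I: "\<And>n. I n \<subseteq> {1..n}" "\<And>n. card ({1..n} - I n) \<le> 2"
    and s1: "filterlim (\<lambda>n. real (s n) / real n) at_top sequentially"
    and s2: "(\<lambda>n. real (s n) / (real n)\<^sup>2) \<longlonglongrightarrow> 0"
  shows "(\<lambda>n. (1 - code_count (I n) (int (s n) - 1) / code_count (I n) (int (s n)))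
            * (real (s n) / real n)) \<longlonglongrightarrow> 1"
proof -
  define a where "a = (\<lambda>n. code_count (I n))"
  define \<rho> where "\<rho> = (\<lambda>n. a n (int (s n) - 1) / a n (int (s n)))"
  have fin: "finite (I n)" for n using I(1) finite_subset by blast
  have apos: "eventually (\<lambda>n. a n (int (s n)) > 0) sequentially"
    unfolding a_def using I s2 by (rule code_count_pos_asymp)
  have spos: "eventually (\<lambda>n. n > 0 \<and> s n > 0) sequentially"
    using filterlim_at_top_dense[THEN iffD1, OF s1, rule_format, of 0]
    by eventually_elim (auto intro!: Nat.gr0I)
  have upper: "eventually (\<lambda>n. (1 - \<rho> n) * (real (s n) / real n) \<le> 1) sequentially"
    using apos spos
  proof eventually_elim
    case (elim n)
    have "card (I n) \<le> card {1..n}" by (intro card_mono I(1)) auto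
    then have cI: "real (card (I n)) \<le> real n" by simp
    have "real (s n) / (real (s n) + real n) \<le> real (s n) / (real (s n) + real (card (I n)))"
      using cI elim by (intro divide_left_mono) auto
    also have "\<dots> \<le> \<rho> n"
      using code_count_ratio_lower[of "I n" "int (s n)"] fin elim by (simp add: \<rho>_def a_def)
    finally have "1 - \<rho> n \<le> 1 - real (s n) / (real (s n) + real n)" by simp
    also have "\<dots> = real n / (real (s n) + real n)" using elim by (simp add: field_simps)
    also have "\<dots> \<le> real n / real (s n)" using elim by (intro divide_left_mono) auto
    finally have "(1 - \<rho> n) * (real (s n) / real n) \<le> real n / real (s n) * (real (s n) / real n)"
      by (intro mult_right_mono) auto
    then show ?case using elim by simp
  qed
  have lower: "eventually (\<lambda>n. \<theta> < (1 - \<rho> n) * (real (s n) / real n)) sequentially"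
    if \<theta>: "0 < \<theta>" "\<theta> < 1" for \<theta>
  proof -
    define M where "M n = nat \<lceil>sqrt (real (s n))\<rceil>" for n
    define r where "r n = 1 - \<theta> * real n / real (s n)" for n
    note exceed = truncated_means_exceed[OF s1 s2 \<theta>, folded M_def r_def]
    have "(\<lambda>n. 1 / real n * (real (M n) / real n)) \<longlonglongrightarrow> 0 * 0"
      by (intro tendsto_mult exceed(1) lim_1_over_n)
    from tendsto_add[OF s2 this]
    have "(\<lambda>n. real (s n + M n) / (real n)\<^sup>2) \<longlonglongrightarrow> 0"
      by (simp add: add_divide_distrib power2_eq_square)
    then have "eventually (\<lambda>n. a n (int (s n + M n)) > 0) sequentially"
      unfolding a_def by (intro code_count_pos_asymp I)
    then show ?thesis
      using exceed(2) apos spos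
    proof eventually_elim
      case (elim n)
      show ?case
      proof (rule ccontr)
        assume "\<not> ?thesis"
        then have "(1 - \<rho> n) * (real (s n) / real n) \<le> \<theta>" by simp
        then have "1 - \<rho> n \<le> \<theta> * real n / real (s n)"
          using elim by (simp add: field_simps)
        then have "r n \<le> \<rho> n" by (simp add: r_def)
        then have "r n * a n (int (s n)) \<le> a n (int (s n) - 1)"
          using elim by (simp add: \<rho>_def pos_le_divide_eq)
        then have "real (card {i\<in>I n. M n \<le> i})
            * ((\<Sum>t<M n. real t * r n ^ t) / (\<Sum>t<M n. r n ^ t)) \<le> of_int (int (s n) + int (M n))"
          using elim fin[of n] by (intro code_count_ratio_upper) (auto simp: a_def)
        \<comment> \<open>At most two indices of \<open>{M n..n}\<close> are missing from
          \<open>I n\<close>.\<close>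
        moreover have "real n - 2 - real (M n) \<le> real (card {i\<in>I n. M n \<le> i})"
        proof -
          have "{M n..n} \<subseteq> {i\<in>I n. M n \<le> i} \<union> ({1..n} - I n)" using elim by auto
          then have "card {M n..n} \<le> card ({i\<in>I n. M n \<le> i} \<union> ({1..n} - I n))"
            using fin by (intro card_mono) auto
          also have "\<dots> \<le> card {i\<in>I n. M n \<le> i} + card ({1..n} - I n)" by (rule card_Un_le)
          also have "\<dots> \<le> card {i\<in>I n. M n \<le> i} + 2" using I(2) by simp
          finally show ?thesis by simp
        qed
        moreover have "0 \<le> (\<Sum>t<M n. real t * r n ^ t) / (\<Sum>t<M n. r n ^ t)"
          using elim by (intro divide_nonneg_nonneg sum_nonneg) auto
        ultimately have "(real n - 2 - real (M n)) * ((\<Sum>t<M n. real t * r n ^ t) / (\<Sum>t<M n. r n ^ t))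
            \<le> of_int (int (s n) + int (M n))"
          by (meson mult_right_mono order_trans)
        then show False using elim by simp
      qed
    qed
  qed
  have "(\<lambda>n. (1 - \<rho> n) * (real (s n) / real n)) \<longlonglongrightarrow> 1"
  proof (rule order_tendstoI)
    fix b :: real assume "b < 1"
    then show "eventually (\<lambda>n. b < (1 - \<rho> n) * (real (s n) / real n)) sequentially"
      \<comment> \<open>The maximum with 1/2 keeps \<theta> positive when \<open>b\<close> is
        not.\<close>
      using lower[of "max b (1 / 2)"] by (auto simp: less_max_iff_disj elim!: eventually_mono)
  next
    fix b :: real assume "1 < b"
    then show "eventually (\<lambda>n. (1 - \<rho> n) * (real (s n) / real n) < b) sequentially"
      using upper by (auto elim!: eventually_mono)
  qed
  then show ?thesis by (simp add: \<rho>_def a_def)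
qed

section \<open>The limit\<close>

text \<open>Squeezes 1 - x between exp(-x/(1-x)) and exp(-x) for x < 1 and raises everything to the
  power \<open>k n\<close>.\<close>

lemma power_one_minus_tendsto_exp:
  fixes x :: "nat \<Rightarrow> real" and k :: "nat \<Rightarrow> nat"
  assumes x: "x \<longlonglongrightarrow> 0" and k: "(\<lambda>n. real (k n) * x n) \<longlonglongrightarrow> \<alpha>"
  shows "(\<lambda>n. (1 - x n) ^ k n) \<longlonglongrightarrow> exp (- \<alpha>)"
proof (rule tendsto_sandwich)
  have x1: "eventually (\<lambda>n. x n < 1) sequentially"
    using x by (rule order_tendstoD) simp
  show "eventually (\<lambda>n. exp (- (real (k n) * x n / (1 - x n))) \<le> (1 - x n) ^ k n) sequentially"
    using x1
  proof eventually_elim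
    case (elim n)
    have "1 / (1 - x n) = 1 + x n / (1 - x n)" using elim by (simp add: field_simps)
    also have "\<dots> \<le> exp (x n / (1 - x n))" by (rule exp_ge_add_one_self)
    finally have "exp (- (x n / (1 - x n))) \<le> 1 - x n"
      using elim by (simp add: exp_minus field_simps)
    then have "exp (- (x n / (1 - x n))) ^ k n \<le> (1 - x n) ^ k n"
      by (intro power_mono) auto
    then show ?case by (simp flip: exp_of_nat_mult)
  qed
  show "eventually (\<lambda>n. (1 - x n) ^ k n \<le> exp (- (real (k n) * x n))) sequentially"
    using x1
  proof eventually_elim
    case (elim n)
    have "(1 - x n) ^ k n \<le> exp (- x n) ^ k n"
      using elim exp_ge_add_one_self[of "- x n"] by (intro power_mono) auto
    then show ?case by (simp flip: exp_of_nat_mult)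
  qed
  show "(\<lambda>n. exp (- (real (k n) * x n))) \<longlonglongrightarrow> exp (- \<alpha>)"
    by (intro tendsto_intros k)
  have "(\<lambda>n. exp (- (real (k n) * x n / (1 - x n)))) \<longlonglongrightarrow> exp (- (\<alpha> / (1 - 0)))"
    by (intro tendsto_intros k x) simp
  then show "(\<lambda>n. exp (- (real (k n) * x n / (1 - x n)))) \<longlonglongrightarrow> exp (- \<alpha>)" by simp
qed

text \<open>This sum and the next are the denominator and numerator in
  \<open>prob_window_inversion\<close> after \<open>a (m - d)\<close> is replaced by
  \<open>q ^ d\<close>, up to the common factor \<open>a m\<close>.\<close>

definition window_sum :: "nat \<Rightarrow> real \<Rightarrow> real" where
  "window_sum k q = (\<Sum>f<k. \<Sum>f'<Suc k. q ^ (f + f'))"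

definition inverted_window_sum :: "nat \<Rightarrow> real \<Rightarrow> real" where
  "inverted_window_sum k q = (\<Sum>f<k. \<Sum>f'<Suc k. of_bool (k \<le> f + f') * q ^ (f + f'))"

lemma window_sum_closed: "(1 - q)\<^sup>2 * window_sum k q = (1 - q ^ k) * (1 - q ^ Suc k)"
proof -
  have "window_sum k q = (\<Sum>f<k. q ^ f) * (\<Sum>f'<Suc k. q ^ f')"
    unfolding window_sum_def sum_product by (simp only: power_add)
  moreover have "(1 - q) * (\<Sum>f<k. q ^ f) = 1 - q ^ k" for k
    by (rule one_diff_power_eq[symmetric])
  ultimately show ?thesis by (metis (no_types, lifting) mult.assoc mult.left_commute power2_eq_square)
qed

lemma inverted_window_sum_closed:
  "(1 - q)\<^sup>2 * inverted_window_sum k q = q ^ k * (real k * (1 - q) - q * (1 - q ^ k))"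
proof -
  \<comment> \<open>The condition leaves \<open>f'\<close> from \<open>k - f\<close> to
    \<open>k\<close>, so \<open>f + f' = k + g\<close> with \<open>g\<close> from 0 to
    \<open>f\<close>.\<close>
  have "(\<Sum>f'<Suc k. of_bool (k \<le> f + f') * q ^ (f + f')) = (\<Sum>g<Suc f. q ^ (k + g))"
    if "f < k" for f
  proof -
    have "(\<Sum>f'<Suc k. of_bool (k \<le> f + f') * q ^ (f + f')) = (\<Sum>f'\<in>{k - f..<Suc k}. q ^ (f + f'))"
      by (rule sum.mono_neutral_cong_right) auto
    also have "\<dots> = (\<Sum>g<Suc f. q ^ (k + g))"
      using that
      by (intro sum.reindex_bij_witness[of _ "\<lambda>g. g + (k - f)" "\<lambda>f'. f' - (k - f)"])
        (auto simp: add.commute)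
    finally show ?thesis .
  qed
  then have "inverted_window_sum k q = (\<Sum>f<k. \<Sum>g<Suc f. q ^ (k + g))"
    unfolding inverted_window_sum_def by (intro sum.cong[OF refl]) (simp only: lessThan_iff)
  also have "\<dots> = q ^ k * (\<Sum>f<k. \<Sum>g<Suc f. q ^ g)"
    by (simp only: power_add sum_distrib_left)
  finally have "(1 - q)\<^sup>2 * inverted_window_sum k q
      = q ^ k * ((1 - q) * (\<Sum>f<k. (1 - q) * (\<Sum>g<Suc f. q ^ g)))"
    by (simp add: power2_eq_square mult_ac flip: sum_distrib_left)
  also have "(\<Sum>f<k. (1 - q) * (\<Sum>g<Suc f. q ^ g)) = (\<Sum>f<k. 1 - q ^ Suc f)"
    by (simp only: one_diff_power_eq)
  also have "\<dots> = real k - q * (\<Sum>f<k. q ^ f)"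
    by (simp add: sum_subtractf sum_distrib_left)
  also have "(1 - q) * \<dots> = real k * (1 - q) - q * ((1 - q) * (\<Sum>f<k. q ^ f))"
    by (simp add: algebra_simps)
  also have "(1 - q) * (\<Sum>f<k. q ^ f) = 1 - q ^ k"
    by (rule one_diff_power_eq[symmetric])
  finally show ?thesis .
qed

text \<open>The closed forms carry the factor (1-q)^2. As \<open>u = (1 - q) / c\<close> tends to 1,
  it can be exchanged for c^2, a normalisation common to all \<open>q\<close> with 1 - q asymptotic
  to \<open>c\<close>. The limits then follow from q^k -> exp(-\<alpha>) and k(1-q) ->
  \<alpha>.\<close>

lemma window_sums_asymp:
  fixes q c :: "nat \<Rightarrow> real" and k :: "nat \<Rightarrow> nat"
  assumes c: "c \<longlonglongrightarrow> 0" and kc: "(\<lambda>n. real (k n) * c n) \<longlonglongrightarrow> \<alpha>"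
    and q: "(\<lambda>n. (1 - q n) / c n) \<longlonglongrightarrow> 1" and c0: "eventually (\<lambda>n. c n \<noteq> 0) sequentially"
  shows "(\<lambda>n. (c n)\<^sup>2 * window_sum (k n) (q n)) \<longlonglongrightarrow> (1 - exp (- \<alpha>))\<^sup>2"
    and "(\<lambda>n. (c n)\<^sup>2 * inverted_window_sum (k n) (q n)) \<longlonglongrightarrow> exp (- \<alpha>) * (\<alpha> - (1 - exp (- \<alpha>)))"
proof -
  define x where "x = (\<lambda>n. 1 - q n)"
  define u where "u = (\<lambda>n. x n / c n)"
  have u: "u \<longlonglongrightarrow> 1" using q by (simp add: u_def x_def)
  have xu: "eventually (\<lambda>n. x n = u n * c n) sequentially"
    using c0 by eventually_elim (simp add: u_def)
  have "(\<lambda>n. u n * c n) \<longlonglongrightarrow> 1 * 0" by (intro tendsto_mult u c)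
  then have x: "x \<longlonglongrightarrow> 0"
    using xu by (simp add: tendsto_cong)
  then have q1: "q \<longlonglongrightarrow> 1" using tendsto_diff[OF tendsto_const x, of 1] by (simp add: x_def)
  have "(\<lambda>n. u n * (real (k n) * c n)) \<longlonglongrightarrow> 1 * \<alpha>" by (intro tendsto_mult u kc)
  moreover have "eventually (\<lambda>n. u n * (real (k n) * c n) = real (k n) * x n) sequentially"
    using xu by eventually_elim simp
  ultimately have kx: "(\<lambda>n. real (k n) * x n) \<longlonglongrightarrow> \<alpha>"
    by (simp add: tendsto_cong)
  have qk: "(\<lambda>n. q n ^ k n) \<longlonglongrightarrow> exp (- \<alpha>)"
    using power_one_minus_tendsto_exp[OF x kx] by (simp add: x_def)
  have u0: "eventually (\<lambda>n. u n > 0) sequentially"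
    using u by (rule order_tendstoD) simp
  have scale: "eventually (\<lambda>n. (x n)\<^sup>2 * F n / (u n)\<^sup>2 = (c n)\<^sup>2 * F n) sequentially" for F :: "nat \<Rightarrow> real"
    using u0 xu by eventually_elim (simp add: power_mult_distrib)
  have "(\<lambda>n. (1 - q n ^ k n) * (1 - q n * q n ^ k n) / (u n)\<^sup>2)
      \<longlonglongrightarrow> (1 - exp (- \<alpha>)) * (1 - 1 * exp (- \<alpha>)) / 1\<^sup>2"
    by (intro tendsto_intros qk q1 u) auto
  then have "(\<lambda>n. (x n)\<^sup>2 * window_sum (k n) (q n) / (u n)\<^sup>2) \<longlonglongrightarrow> (1 - exp (- \<alpha>))\<^sup>2"
    by (simp add: x_def window_sum_closed power2_eq_square[of "1 - exp (- \<alpha>)"])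
  then show "(\<lambda>n. (c n)\<^sup>2 * window_sum (k n) (q n)) \<longlonglongrightarrow> (1 - exp (- \<alpha>))\<^sup>2"
    by (rule Lim_transform_eventually) (rule scale)
  have "(\<lambda>n. q n ^ k n * (real (k n) * x n - q n * (1 - q n ^ k n)) / (u n)\<^sup>2)
      \<longlonglongrightarrow> exp (- \<alpha>) * (\<alpha> - 1 * (1 - exp (- \<alpha>))) / 1\<^sup>2"
    by (intro tendsto_intros qk q1 u kx) auto
  then have "(\<lambda>n. (x n)\<^sup>2 * inverted_window_sum (k n) (q n) / (u n)\<^sup>2)
      \<longlonglongrightarrow> exp (- \<alpha>) * (\<alpha> - (1 - exp (- \<alpha>)))"
    by (simp add: x_def inverted_window_sum_closed)
  then show "(\<lambda>n. (c n)\<^sup>2 * inverted_window_sum (k n) (q n)) \<longlonglongrightarrow> exp (- \<alpha>) * (\<alpha> - (1 - exp (- \<alpha>)))"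
    by (rule Lim_transform_eventually) (rule scale)
qed

text \<open>Clearing denominators turns the claim into 2\<alpha> < exp(\<alpha>) - exp(-\<alpha>),
  that is \<alpha> < sinh \<alpha>. The difference \<open>g\<close> vanishes at 0 and has derivative
  (exp(x) - 1)^2 / exp(x) > 0 for x > 0.\<close>

lemma inversion_limit_less_half:
  fixes \<alpha> :: real
  assumes "\<alpha> > 0"
  shows "(exp \<alpha> * (\<alpha> - 1) + 1) / (exp \<alpha> - 1)\<^sup>2 < 1 / 2"
proof -
  define g where "g = (\<lambda>x::real. exp x - exp (- x) - 2 * x)"
  have "g 0 < g \<alpha>"
  proof (rule DERIV_pos_imp_increasing_open[OF assms])
    fix x :: real assume x: "0 < x" "x < \<alpha>"
    have "(g has_real_derivative exp x + exp (- x) - 2) (at x)"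
      unfolding g_def by (auto intro!: derivative_eq_intros)
    moreover have "exp x + exp (- x) - 2 > 0"
    proof -
      have "0 < (exp x - 1)\<^sup>2" using x by simp
      then have "0 < (exp x - 1)\<^sup>2 / exp x" by (intro divide_pos_pos) auto
      also have "\<dots> = exp x + exp (- x) - 2"
        by (simp add: exp_minus field_simps power2_eq_square)
      finally show ?thesis .
    qed
    ultimately show "\<exists>y. (g has_real_derivative y) (at x) \<and> 0 < y" by blast
  qed (auto simp: g_def intro!: continuous_intros)
  then have "0 < exp \<alpha> * (exp \<alpha> - exp (- \<alpha>) - 2 * \<alpha>)" by (simp add: g_def)
  then have "2 * (exp \<alpha> * (\<alpha> - 1) + 1) < (exp \<alpha> - 1)\<^sup>2"
    by (simp add: exp_minus algebra_simps power2_eq_square)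
  moreover have "(exp \<alpha> - 1)\<^sup>2 > 0" using assms by simp
  ultimately show ?thesis by (simp add: divide_simps)
qed

lemma inversion_limit_eq:
  fixes \<alpha> :: real
  assumes "\<alpha> > 0"
  shows "exp (- \<alpha>) * (\<alpha> - (1 - exp (- \<alpha>))) / (1 - exp (- \<alpha>))\<^sup>2
       = (exp \<alpha> * (\<alpha> - 1) + 1) / (exp \<alpha> - 1)\<^sup>2"
proof -
  define E where "E = exp \<alpha>"
  have E: "E > 1" "exp (- \<alpha>) = 1 / E" using assms by (simp_all add: E_def exp_minus field_simps)
  have "1 / E * (\<alpha> - (1 - 1 / E)) = (E * (\<alpha> - 1) + 1) / E\<^sup>2"
    using E by (simp add: field_simps power2_eq_square)
  moreover have "(1 - 1 / E)\<^sup>2 = (E - 1)\<^sup>2 / E\<^sup>2"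
    using E by (simp add: field_simps power2_eq_square)
  ultimately show ?thesis unfolding E(2) E_def[symmetric] using E by simp
qed

theorem theorem5:
  fixes m k j :: "nat \<Rightarrow> nat" and \<alpha> :: real
  assumes "\<And>n. m n > 0" and "\<And>n. k n > 0"
    and "(\<lambda>n. real n) \<in> o[sequentially](\<lambda>n. real (m n))"
    and "(\<lambda>n. real (m n)) \<in> o[sequentially](\<lambda>n. (real n)\<^sup>2 / (ln (real n))\<^sup>2)"
    and "\<alpha> > 0"
    and "(\<lambda>n. real (k n)) \<sim>[sequentially] (\<lambda>n. \<alpha> * real (m n) / real n)"
    and "\<And>n. j n > 0" and "eventually (\<lambda>n. j n + k n \<le> n) sequentially"
  shows "(\<lambda>n. measure_pmf.prob (random_perm n (m n)) {\<sigma>. \<sigma> (j n) > \<sigma> (j n + k n)})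
           \<longlonglongrightarrow> (exp \<alpha> * (\<alpha> - 1) + 1) / (exp \<alpha> - 1)\<^sup>2
         \<and> (exp \<alpha> * (\<alpha> - 1) + 1) / (exp \<alpha> - 1)\<^sup>2 < 1 / 2"
proof
  show "(exp \<alpha> * (\<alpha> - 1) + 1) / (exp \<alpha> - 1)\<^sup>2 < 1 / 2"
    using assms(5) by (rule inversion_limit_less_half)
  define c where "c = (\<lambda>n. real n / real (m n))"
  have c: "c \<longlonglongrightarrow> 0" unfolding c_def using assms(3) by (rule smalloD_tendsto)
  have cpos: "eventually (\<lambda>n. c n > 0) sequentially"
    using eventually_gt_at_top[of 0] by eventually_elim (simp add: c_def assms(1))
  have m1: "filterlim (\<lambda>n. real (m n) / real n) at_top sequentially"
  proof -
    have "filterlim c (at_right 0) sequentially"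
      using c cpos by (rule tendsto_imp_filterlim_at_right)
    then have "filterlim (\<lambda>n. inverse (c n)) at_top sequentially"
      by (rule filterlim_compose[OF filterlim_inverse_at_top_right])
    then show ?thesis by (simp add: c_def)
  qed
  have m2: "(\<lambda>n. real (m n) / (real n)\<^sup>2) \<longlonglongrightarrow> 0"
  proof (rule smalloD_tendsto)
    have "(\<lambda>n. (real n)\<^sup>2 / (ln (real n))\<^sup>2) \<in> O(\<lambda>n. (real n)\<^sup>2)" by real_asymp
    then show "(\<lambda>n. real (m n)) \<in> o(\<lambda>n. (real n)\<^sup>2)"
      by (rule landau_o.small_big_trans[OF assms(4)])
  qed
  have kc: "(\<lambda>n. real (k n) * c n) \<longlonglongrightarrow> \<alpha>"
  proof (rule Lim_transform_eventually)
    have nz: "eventually (\<lambda>n. \<alpha> * real (m n) / real n \<noteq> 0) sequentially"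
      using eventually_gt_at_top[of 0] by eventually_elim (use assms(1,5) in \<open>simp add: less_imp_neq\<close>)
    have "(\<lambda>n. real (k n) / (\<alpha> * real (m n) / real n)) \<longlonglongrightarrow> 1"
      by (rule asymp_equivD_strong[OF assms(6)]) (rule eventually_mono[OF nz], simp)
    from tendsto_mult[OF tendsto_const this, of \<alpha>]
    show "(\<lambda>n. \<alpha> * (real (k n) / (\<alpha> * real (m n) / real n))) \<longlonglongrightarrow> \<alpha>" by simp
    show "eventually (\<lambda>n. \<alpha> * (real (k n) / (\<alpha> * real (m n) / real n)) = real (k n) * c n) sequentially"
      using nz by eventually_elim (use assms(5) in \<open>simp add: c_def\<close>)
  qed
  have km: "(\<lambda>n. real (k n) / real (m n)) \<longlonglongrightarrow> 0"
  proof (rule Lim_transform_eventually)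
    show "(\<lambda>n. real (k n) * c n * (1 / real n)) \<longlonglongrightarrow> 0"
      using tendsto_mult[OF kc lim_1_over_n] by simp
    show "eventually (\<lambda>n. real (k n) * c n * (1 / real n) = real (k n) / real (m n)) sequentially"
      using eventually_gt_at_top[of 0] by eventually_elim (simp add: c_def)
  qed
  \<comment> \<open>The largest value of \<open>f + f'\<close> is \<open>2 * k - 1\<close>, so every
    argument \<open>m - f - f'\<close> lies between \<open>s\<close> and \<open>m\<close>. As k =
    o(m), \<open>s\<close> is asymptotic to \<open>m\<close>.\<close>
  define s where "s = (\<lambda>n. m n - 2 * k n)"
  have ksmall: "eventually (\<lambda>n. 4 * k n \<le> m n) sequentially"
  proof -
    have "eventually (\<lambda>n. real (k n) / real (m n) < 1 / 4) sequentially"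
      using km by (rule order_tendstoD) simp
    then show ?thesis
    proof eventually_elim
      case (elim n)
      then have "4 * real (k n) < real (m n)" using assms(1)[of n] by (simp add: divide_simps)
      then show ?case by linarith
    qed
  qed
  have sm: "(\<lambda>n. real (s n) / real (m n)) \<longlonglongrightarrow> 1"
  proof (rule Lim_transform_eventually)
    have "(\<lambda>n. 1 - 2 * (real (k n) / real (m n))) \<longlonglongrightarrow> 1 - 2 * 0" by (intro tendsto_intros km)
    then show "(\<lambda>n. 1 - 2 * (real (k n) / real (m n))) \<longlonglongrightarrow> 1" by simp
    show "eventually (\<lambda>n. 1 - 2 * (real (k n) / real (m n)) = real (s n) / real (m n)) sequentially"
      using ksmall by eventually_elim (use assms(1) in \<open>simp add: s_def of_nat_diff diff_divide_distrib less_imp_neq\<close>)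
  qed
  have s1: "filterlim (\<lambda>n. real (s n) / real n) at_top sequentially"
  proof (rule filterlim_at_top_mono)
    show "filterlim (\<lambda>n. 1 / 2 * (real (m n) / real n)) at_top sequentially"
      by (rule filterlim_tendsto_pos_mult_at_top[OF tendsto_const _ m1]) simp
    show "eventually (\<lambda>n. 1 / 2 * (real (m n) / real n) \<le> real (s n) / real n) sequentially"
      using ksmall
    proof eventually_elim
      case (elim n)
      then have "real (m n) / 2 \<le> real (s n)" by (simp add: s_def of_nat_diff)
      then have "real (m n) / 2 / real n \<le> real (s n) / real n" by (rule divide_right_mono) simp
      then show ?case by simp
    qed
  qed
  have s2: "(\<lambda>n. real (s n) / (real n)\<^sup>2) \<longlonglongrightarrow> 0"
  proof (rule tendsto_sandwich[OF _ _ tendsto_const m2])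
    show "eventually (\<lambda>n. real (s n) / (real n)\<^sup>2 \<le> real (m n) / (real n)\<^sup>2) sequentially"
      by (intro always_eventually allI divide_right_mono) (auto simp: s_def)
  qed auto
  define I where "I = (\<lambda>n. {1..n} - {k n, Suc (k n)})"
  define a where "a = (\<lambda>n. code_count (I n))"
  have I1: "I n \<subseteq> {1..n}" for n by (auto simp: I_def)
  have I2: "card ({1..n} - I n) \<le> 2" for n
  proof -
    have "card ({1..n} - I n) \<le> card {k n, Suc (k n)}" by (intro card_mono) (auto simp: I_def)
    then show ?thesis by simp
  qed
  \<comment> \<open>Ratios increase, so \<open>qU\<close>, taken at the top of the range, bounds the
    decay from above, and \<open>qL\<close>, taken at the bottom, bounds it from below. Both equal 1
    - (1 + o(1)) c.\<close>
  define qU where "qU = (\<lambda>n. a n (int (m n) - 1) / a n (int (m n)))"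
  define qL where "qL = (\<lambda>n. a n (int (s n) - 1) / a n (int (s n)))"
  have qU: "(\<lambda>n. (1 - qU n) / c n) \<longlonglongrightarrow> 1"
    using code_count_ratio_asymp[OF I1 I2 m1 m2] by (simp add: qU_def a_def c_def)
  have qL: "(\<lambda>n. (1 - qL n) / c n) \<longlonglongrightarrow> 1"
  proof (rule Lim_transform_eventually)
    show "(\<lambda>n. (1 - qL n) * (real (s n) / real n) / (real (s n) / real (m n))) \<longlonglongrightarrow> 1"
      using tendsto_divide[OF code_count_ratio_asymp[OF I1 I2 s1 s2] sm] by (simp add: qL_def a_def)
    show "eventually (\<lambda>n. (1 - qL n) * (real (s n) / real n) / (real (s n) / real (m n)) = (1 - qL n) / c n) sequentially"
      using ksmall
    proof eventually_elim
      case (elim n)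
      then have "s n > 0" using assms(1)[of n] by (simp add: s_def)
      then show ?case by (simp add: c_def)
    qed
  qed
  have cnz: "eventually (\<lambda>n. c n \<noteq> 0) sequentially" using cpos by eventually_elim simp
  note U = window_sums_asymp[OF c kc qU cnz] and L = window_sums_asymp[OF c kc qL cnz]
  let ?lim = "exp (- \<alpha>) * (\<alpha> - (1 - exp (- \<alpha>))) / (1 - exp (- \<alpha>))\<^sup>2"
  have lim: "(\<lambda>n. X n / Y n) \<longlonglongrightarrow> ?lim"
    if "(\<lambda>n. (c n)\<^sup>2 * X n) \<longlonglongrightarrow> exp (- \<alpha>) * (\<alpha> - (1 - exp (- \<alpha>)))"
      and "(\<lambda>n. (c n)\<^sup>2 * Y n) \<longlonglongrightarrow> (1 - exp (- \<alpha>))\<^sup>2" for X Y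
  proof (rule Lim_transform_eventually)
    show "(\<lambda>n. ((c n)\<^sup>2 * X n) / ((c n)\<^sup>2 * Y n)) \<longlonglongrightarrow> ?lim"
      by (intro tendsto_divide that) (use assms(5) in simp)
    show "eventually (\<lambda>n. ((c n)\<^sup>2 * X n) / ((c n)\<^sup>2 * Y n) = X n / Y n) sequentially"
      using cnz by eventually_elim simp
  qed
  have posm: "eventually (\<lambda>n. a n (int (m n)) > 0) sequentially"
    unfolding a_def by (rule code_count_pos_asymp[OF I1 I2 m2])
  have poss: "eventually (\<lambda>n. a n (int (s n)) > 0) sequentially"
    unfolding a_def by (rule code_count_pos_asymp[OF I1 I2 s2])
  have qLpos: "eventually (\<lambda>n. qL n > 0) sequentially"
    using poss ksmall
  proof (eventually_elim)
    case (elim n)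
    have "0 < real (s n) / (real (s n) + real (card (I n)))"
      using elim assms(1)[of n] by (auto simp: s_def intro!: divide_pos_pos add_pos_nonneg)
    also have "\<dots> \<le> qL n"
      using code_count_ratio_lower[of "I n" "int (s n)"] elim by (simp add: qL_def a_def I_def)
    finally show ?case .
  qed
  let ?P = "\<lambda>n. measure_pmf.prob (random_perm n (m n)) {\<sigma>. \<sigma> (j n) > \<sigma> (j n + k n)}"
  \<comment> \<open>A quotient is bounded below by pairing the lower estimate of the numerator with
    the upper one of the denominator, and above by the opposite pairing. The factor
    \<open>a m\<close> cancels.\<close>
  have bounds: "eventually (\<lambda>n.
      inverted_window_sum (k n) (qL n) / window_sum (k n) (qU n) \<le> ?P n \<and>
      ?P n \<le> inverted_window_sum (k n) (qU n) / window_sum (k n) (qL n)) sequentially"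
    using posm poss ksmall qLpos assms(8)
  proof eventually_elim
    case (elim n)
    define N where "N = (\<Sum>f<k n. \<Sum>f'<Suc (k n). of_bool (k n \<le> f + f') * a n (int (m n) - int (f + f')))"
    define D where "D = (\<Sum>f<k n. \<Sum>f'<Suc (k n). a n (int (m n) - int (f + f')))"
    define A where "A = a n (int (m n))"
    have A: "A > 0" using elim by (simp add: A_def)
    have P: "?P n = N / D"
      unfolding N_def D_def a_def I_def
      by (rule prob_window_inversion) (use elim assms in \<open>auto simp: a_def I_def\<close>)
    have lc: "log_concave (a n)" by (simp add: a_def I_def log_concave_code_count)
    have qU0: "qU n \<ge> 0" by (simp add: qU_def a_def code_count_nonneg)
    have up: "a n (int (m n) - int d) \<le> A * qU n ^ d" for d
      using log_concave_ratio_upper[OF lc _ qU0, of "int (m n)" d] A by (simp add: A_def qU_def mult.commute)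
    have low: "A * qL n ^ d \<le> a n (int (m n) - int d)" if "d \<le> 2 * k n" for d
      using log_concave_ratio_lower[OF lc, of "int (s n)" "qL n" "int (m n) - int d" d] elim that
      by (simp add: A_def qL_def s_def of_nat_diff mult.commute)
    have N1: "N \<le> A * inverted_window_sum (k n) (qU n)"
      unfolding N_def inverted_window_sum_def sum_distrib_left
      by (intro sum_mono) (use up in \<open>auto simp del: of_nat_add\<close>)
    have D1: "D \<le> A * window_sum (k n) (qU n)"
      unfolding D_def window_sum_def sum_distrib_left by (intro sum_mono up)
    have N2: "A * inverted_window_sum (k n) (qL n) \<le> N"
      unfolding N_def inverted_window_sum_def sum_distrib_left
      by (intro sum_mono) (use low in \<open>auto simp del: of_nat_add\<close>)
    have D2: "A * window_sum (k n) (qL n) \<le> D"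
      unfolding D_def window_sum_def sum_distrib_left by (intro sum_mono low) auto
    have wpos: "window_sum (k n) (qL n) > 0"
      unfolding window_sum_def using elim assms(2)[of n]
      by (intro sum_pos) (auto simp: lessThan_empty_iff simp del: sum.lessThan_Suc)
    have ipos: "inverted_window_sum (k n) (qL n) \<ge> 0"
      unfolding inverted_window_sum_def using elim by (intro sum_nonneg) auto
    have D0: "D > 0" using D2 A wpos by (meson less_le_trans mult_pos_pos)
    have N0: "N \<ge> 0" using N2 A ipos by (meson mult_nonneg_nonneg less_imp_le order_trans)
    have "A * inverted_window_sum (k n) (qL n) / (A * window_sum (k n) (qU n)) \<le> N / D"
      using N0 N2 D1 D0 by (intro frac_le) auto
    moreover have "N / D \<le> A * inverted_window_sum (k n) (qU n) / (A * window_sum (k n) (qL n))"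
      using N0 N1 D2 A wpos by (intro frac_le) auto
    ultimately show ?case unfolding P using A by simp
  qed
  show "?P \<longlonglongrightarrow> (exp \<alpha> * (\<alpha> - 1) + 1) / (exp \<alpha> - 1)\<^sup>2"
    unfolding inversion_limit_eq[OF assms(5), symmetric]
  \<comment> \<open>Mixing \<open>qL\<close> and \<open>qU\<close> is harmless: the c^2-normalised
    window sums have the same limits for both.\<close>
  proof (rule tendsto_sandwich)
    show "(\<lambda>n. inverted_window_sum (k n) (qL n) / window_sum (k n) (qU n)) \<longlonglongrightarrow> ?lim"
      by (rule lim[OF L(2) U(1)])
    show "(\<lambda>n. inverted_window_sum (k n) (qU n) / window_sum (k n) (qL n)) \<longlonglongrightarrow> ?lim"
      by (rule lim[OF U(2) L(1)])
  qed (use bounds in \<open>auto elim: eventually_mono\<close>)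
qed

end
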